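(* Let $k\ge 1$ be an integer, $x\in\{3,4,5\}$ and $\theta = 2\pi/(4k+x)$. Define $\boldsymbol{c} = 1/(\cos(\theta/2)-\sin(\theta/2))$ if $x=4$, and $\boldsymbol{c} = \cos(\theta/4)/(\cos(\theta/2)-\sin(3\theta/4))$ if $x\in\{3,5\}$ (in all cases $\boldsymbol{c}\ge 1$). Let $P$ be a finite set of points in general position and $S$ a set of constraints on $P$. Let $u,w\in P$ be two vertices such that $u$ can see $w$, let $m$ be the midpoint of the side of the canonical triangle $T_{uw}$ opposite $u$, and let $\alpha$ be the unsigned angle between $uw$ and $um$. Then there exists a path connecting $u$ and $w$ in the constrained $\theta_{(4k+x)}$-graph of $P$ with respect to $S$ of length at most \[\left( \frac{\cos \alpha}{\cos \left(\frac{\theta}{2}\right)} + \left(\cos \alpha \cdot \tan \left(\frac{\theta}{2}\right) + \sin \alpha\right) \cdot \boldsymbol{c} \right) \cdot |u w|.\]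
   Context: $P$ is a finite set of points in the plane and $S$ is a set of line segments (called constraints), each joining two points of $P$, such that no two constraints intersect properly. Two points $u,v\in P$ can see each other if and only if the segment $uv$ does not properly intersect any constraint or $uv$ is itself a constraint. Fix an integer $k\ge 1$, $x\in\{2,3,4,5\}$ and $\theta=2\pi/(4k+x)$. Around each point $u$, the $4k+x$ rays from $u$ with angle $\theta$ between consecutive rays define cones; they are oriented so that the bisector of one cone, $C_0^u$, is the vertical half-line above $u$, and the cones are numbered $C_0^u, C_1^u, \dots$ clockwise; all points use the same orientation. For every constraint $uv$ with $v\in C_i^u$, the line through that constraint splits $C_i^u$; the resulting pieces are the subcones of $C_i^u$ (if a constraint $uv$ splits a cone of $u$ into two subcones, $v$ is considered to lie in both; a cone not split is a single subcone). The constrained $\theta_{(4k+x)}$-graph has vertex set $P$ and, for each vertex $u$ and each subcone of each cone $C_i^u$, an edge between $u$ and the vertex $v$ of that subcone that can see $u$ and whose orthogonal projection onto the bisector of the full cone $C_i^u$ (not of the subcone) is closest to $u$ among all vertices of that subcone that can see $u$. Edges are weighted by Euclidean length, and the length of a path is the sum of its edge lengths. General position: no two points lie on a line parallel to one of the rays defining the cones, no two points lie on a line perpendicular to the bisector of a cone, and no three points are collinear. For a vertex $w$ in cone $C_i^u$, the canonical triangle $T_{uw}$ is the triangle bounded by the two boundary rays of $C_i^u$ and the line through $w$ perpendicular to the bisector of $C_i^u$. *)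

theory Defs
  imports "HOL-Analysis.Analysis"
begin

type_synonym pt = "real \<times> real"

definition theta :: "nat \<Rightarrow> real" where
  "theta N = 2 * pi / real N"

text \<open>Unit bisector of cone i (clockwise from the upward vertical).\<close>
definition bis :: "nat \<Rightarrow> nat \<Rightarrow> pt" where
  "bis N i = (sin (real i * theta N), cos (real i * theta N))"

text \<open>Direction of the j-th cone-boundary ray.\<close>
definition ray_dir :: "nat \<Rightarrow> nat \<Rightarrow> pt" where
  "ray_dir N j = (sin ((2 * real j + 1) * theta N / 2), cos ((2 * real j + 1) * theta N / 2))"

definition cross2 :: "pt \<Rightarrow> pt \<Rightarrow> real" where
  "cross2 a b = fst a * snd b - snd a * fst b"

definition orient :: "pt \<Rightarrow> pt \<Rightarrow> pt \<Rightarrow> real" where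
  "orient u a b = cross2 (a - u) (b - u)"

definition in_cone :: "nat \<Rightarrow> nat \<Rightarrow> pt \<Rightarrow> pt \<Rightarrow> bool" where
  "in_cone N i u v \<longleftrightarrow> i < N \<and> v \<noteq> u \<and>
     (v - u) \<bullet> bis N i \<ge> norm (v - u) * cos (theta N / 2)"

definition crosses :: "pt \<Rightarrow> pt \<Rightarrow> pt \<Rightarrow> pt \<Rightarrow> bool" where
  "crosses a b c d \<longleftrightarrow> open_segment a b \<inter> open_segment c d \<noteq> {}"

text \<open>Constraints are given as pairs, read as unordered segments.\<close>
definition is_constraint :: "(pt \<times> pt) set \<Rightarrow> pt \<Rightarrow> pt \<Rightarrow> bool" where
  "is_constraint S a b \<longleftrightarrow> (a, b) \<in> S \<or> (b, a) \<in> S"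

definition valid_constraints :: "pt set \<Rightarrow> (pt \<times> pt) set \<Rightarrow> bool" where
  "valid_constraints P S \<longleftrightarrow>
     (\<forall>(a, b) \<in> S. a \<in> P \<and> b \<in> P \<and> a \<noteq> b) \<and>
     (\<forall>(a, b) \<in> S. \<forall>(c, d) \<in> S. {a, b} \<noteq> {c, d} \<longrightarrow> \<not> crosses a b c d)"

definition visible :: "(pt \<times> pt) set \<Rightarrow> pt \<Rightarrow> pt \<Rightarrow> bool" where
  "visible S a b \<longleftrightarrow> is_constraint S a b \<or> (\<forall>(c, d) \<in> S. \<not> crosses a b c d)"

definition general_position :: "nat \<Rightarrow> pt set \<Rightarrow> bool" where
  "general_position N P \<longleftrightarrow>
     (\<forall>p \<in> P. \<forall>q \<in> P. p \<noteq> q \<longrightarrow>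
        (\<forall>j < N. cross2 (q - p) (ray_dir N j) \<noteq> 0) \<and>
        (\<forall>i < N. (q - p) \<bullet> bis N i \<noteq> 0)) \<and>
     (\<forall>a \<in> P. \<forall>b \<in> P. \<forall>c \<in> P. a \<noteq> b \<and> a \<noteq> c \<and> b \<noteq> c \<longrightarrow> orient a b c \<noteq> 0)"

definition cons_ray :: "(pt \<times> pt) set \<Rightarrow> nat \<Rightarrow> nat \<Rightarrow> pt \<Rightarrow> pt \<Rightarrow> bool" where
  "cons_ray S N i u v \<longleftrightarrow> is_constraint S u v \<and> in_cone N i u v"

text \<open>r is a reference point in the interior of some subcone of C_i of u
  (not on any constraint ray of u in that cone).\<close>
definition subcone_ref :: "(pt \<times> pt) set \<Rightarrow> nat \<Rightarrow> nat \<Rightarrow> pt \<Rightarrow> pt \<Rightarrow> bool" where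
  "subcone_ref S N i u r \<longleftrightarrow> in_cone N i u r \<and> (\<forall>v. cons_ray S N i u v \<longrightarrow> orient u v r \<noteq> 0)"

text \<open>w lies in the subcone of C_i of u containing the reference point r
  (closed: points on the bounding constraint rays belong to it).\<close>
definition in_subcone :: "(pt \<times> pt) set \<Rightarrow> nat \<Rightarrow> nat \<Rightarrow> pt \<Rightarrow> pt \<Rightarrow> pt \<Rightarrow> bool" where
  "in_subcone S N i u r w \<longleftrightarrow> in_cone N i u w \<and>
     \<not> (\<exists>v. cons_ray S N i u v \<and> orient u r v * orient u v w > 0)"

definition selects :: "pt set \<Rightarrow> (pt \<times> pt) set \<Rightarrow> nat \<Rightarrow> pt \<Rightarrow> pt \<Rightarrow> bool" where
  "selects P S N u v \<longleftrightarrow> u \<in> P \<and> v \<in> P \<and>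
     (\<exists>i r. subcone_ref S N i u r \<and> in_subcone S N i u r v \<and> visible S u v \<and>
        (\<forall>w \<in> P. in_subcone S N i u r w \<and> visible S u w \<longrightarrow>
            (v - u) \<bullet> bis N i \<le> (w - u) \<bullet> bis N i))"

definition theta_edge :: "pt set \<Rightarrow> (pt \<times> pt) set \<Rightarrow> nat \<Rightarrow> pt \<Rightarrow> pt \<Rightarrow> bool" where
  "theta_edge P S N u v \<longleftrightarrow> selects P S N u v \<or> selects P S N v u"

definition is_path :: "(pt \<Rightarrow> pt \<Rightarrow> bool) \<Rightarrow> pt list \<Rightarrow> pt \<Rightarrow> pt \<Rightarrow> bool" where
  "is_path E xs u w \<longleftrightarrow> xs \<noteq> [] \<and> hd xs = u \<and> last xs = w \<and>
     (\<forall>j < length xs - 1. E (xs ! j) (xs ! Suc j))"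

definition path_len :: "pt list \<Rightarrow> real" where
  "path_len xs = (\<Sum>j < length xs - 1. dist (xs ! j) (xs ! Suc j))"

text \<open>Midpoint of the side of the canonical triangle T_uw opposite u (w in cone C_i of u).\<close>
definition canon_mid :: "nat \<Rightarrow> nat \<Rightarrow> pt \<Rightarrow> pt \<Rightarrow> pt" where
  "canon_mid N i u w = u + ((w - u) \<bullet> bis N i) *\<^sub>R bis N i"

definition vangle :: "pt \<Rightarrow> pt \<Rightarrow> real" where
  "vangle a b = arccos ((a \<bullet> b) / (norm a * norm b))"

definition cconst :: "nat \<Rightarrow> nat \<Rightarrow> real" where
  "cconst N x = (if x = 4 then 1 / (cos (theta N / 2) - sin (theta N / 2))
                 else cos (theta N / 4) / (cos (theta N / 2) - sin (3 * theta N / 4)))"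

end

theory Submission
  imports Defs
begin

text \<open>
  Write \<open>h = \<theta> / 2\<close> and let \<open>F d = (1 / cos h + c tan h) y + c \<bar>x\<bar>\<close>, where \<open>y\<close> and \<open>x\<close> are the
  coordinates of \<open>d\<close> along and across the bisector of the cone that contains \<open>d\<close>. Then \<open>F (w - u)\<close> is the
  claimed bound, and it is proved for all visible pairs by induction on the height of the canonical
  triangle.

  If \<open>v\<close> is the neighbour of \<open>u\<close> in the subcone containing \<open>w\<close>, then the hull of the points in the triangle
  \<open>u v w\<close> has, on the side facing \<open>u\<close>, a convex chain of visible pairs from \<open>v\<close> to \<open>w\<close>, to which the induction hypothesis
  applies. In the coordinates of the cone of \<open>u\<close> (with \<open>v\<close> to the left of \<open>u w\<close>), every edge of the chain
  costs at most \<open>(1 / cos h + c tan h) \<Delta>y + c \<bar>\<Delta>x\<bar>\<close>. For an edge at angle \<open>\<phi>\<close> to the bisector of \<open>u\<close> and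
  at angle \<open>\<psi>\<close> to the bisector of its own cone, this amounts to \<open>c cos (s + h) \<ge> sin s\<close> for
  \<open>s = (\<phi> + \<bar>\<psi>\<bar>) / 2\<close>. The constant is \<open>c = sin M / cos (M + h)\<close>, where \<open>M = \<pi> / 4\<close> if \<open>4\<close> divides the
  number of cones and \<open>M = \<pi> / 4 + \<theta> / 8\<close> if that number is odd, and \<open>s \<le> M\<close> always holds. Since the
  chain is convex, it changes its horizontal direction at most once, and the costs add up to \<open>F (w - u)\<close>.
\<close>

section \<open>Paths\<close>

definition reach :: "(pt \<Rightarrow> pt \<Rightarrow> bool) \<Rightarrow> pt \<Rightarrow> pt \<Rightarrow> real \<Rightarrow> bool" where
  "reach E p q l \<longleftrightarrow> (\<exists>xs. is_path E xs p q \<and> path_len xs \<le> l)"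

lemma is_path_Cons:
  assumes "is_path E zs q r" "E p q"
  shows "is_path E (p # zs) p r"
proof -
  obtain y ys where zs: "zs = y # ys" using assms(1) by (cases zs) (auto simp: is_path_def)
  have "E ((p # zs) ! j) ((p # zs) ! Suc j)" if "j < length zs" for j
    using that assms zs by (cases j) (auto simp: is_path_def)
  then show ?thesis using assms zs by (auto simp: is_path_def)
qed

lemma path_len_Cons:
  assumes "zs \<noteq> []"
  shows "path_len (p # zs) = dist p (hd zs) + path_len zs"
proof -
  obtain y ys where zs: "zs = y # ys" using assms by (cases zs) auto
  show ?thesis unfolding zs path_len_def by (simp add: sum.lessThan_Suc_shift del: sum.lessThan_Suc)
qed

lemma is_path_append:
  assumes "is_path E xs p q" "is_path E ys q r"
  shows "\<exists>zs. is_path E zs p r \<and> path_len zs = path_len xs + path_len ys"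
  using assms(1)
proof (induction xs arbitrary: p)
  case Nil
  then show ?case by (simp add: is_path_def)
next
  case (Cons x xs)
  show ?case
  proof (cases xs)
    case Nil
    then have "p = q" using Cons.prems by (auto simp: is_path_def)
    then show ?thesis using assms(2) Nil by (auto simp: path_len_def)
  next
    case (Cons y ys')
    have x: "x = p" using Cons.prems by (simp add: is_path_def)
    have E: "E p y" using Cons.prems Cons x by (auto simp: is_path_def)
    have "E (xs ! j) (xs ! Suc j)" if "j < length xs - 1" for j
    proof -
      have "Suc j < length (x # xs) - 1" using that by simp
      then have "E ((x # xs) ! Suc j) ((x # xs) ! Suc (Suc j))"
        using Cons.prems unfolding is_path_def by blast
      then show ?thesis by simp
    qed
    then have "is_path E xs y q" using Cons.prems Cons by (auto simp: is_path_def)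
    from Cons.IH[OF this] obtain zs where zs: "is_path E zs y r" "path_len zs = path_len xs + path_len ys"
      by blast
    have "is_path E (p # zs) p r" using is_path_Cons zs(1) E by blast
    moreover have "path_len (p # zs) = path_len (x # xs) + path_len ys"
      using zs path_len_Cons[of zs p] path_len_Cons[of xs x] Cons x by (auto simp: is_path_def)
    ultimately show ?thesis by blast
  qed
qed

lemma reach_trans:
  assumes "reach E p q l1" "reach E q r l2"
  shows "reach E p r (l1 + l2)"
  using assms is_path_append unfolding reach_def by (metis add_mono)

lemma reach_mono: "reach E p q l1 \<Longrightarrow> l1 \<le> l2 \<Longrightarrow> reach E p q l2"
  unfolding reach_def by force

lemma reach_edge:
  assumes "E p q" shows "reach E p q (dist p q)"
  unfolding reach_def
  by (rule exI[of _ "[p, q]"]) (use assms in \<open>auto simp: is_path_def path_len_def\<close>)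

section \<open>Cones and the constant\<close>

text \<open>The extreme case \<open>N = 7\<close> of \<open>2 * tan (theta N / 2) < 1\<close>, which
  makes heights decrease in \<open>edge_cone_bound\<close>. Since
  \<open>sin (4 * (pi / 7)) = sin (3 * (pi / 7))\<close>, the number \<open>cos (pi / 7)\<close> is
  a root of a cubic, and this forces its square above \<open>4 / 5\<close>.\<close>

lemma tan_pi_div_7_less_half: "2 * tan (pi / 7) < 1"
proof -
  define c s where "c = cos (pi / 7)" and "s = sin (pi / 7)"
  have s0: "s > 0" unfolding s_def by (rule sin_gt_zero) auto
  have ch: "1 / 2 < c" unfolding c_def
    using cos_monotone_0_pi[of "pi/7" "pi/3"] by (simp add: cos_60)
  have cs: "c\<^sup>2 + s\<^sup>2 = 1" by (simp add: c_def s_def)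
  have "sin (4 * (pi / 7)) = sin (3 * (pi / 7))"
    using sin_pi_minus[of "3 * (pi / 7)"] by (simp add: field_simps)
  moreover have "sin (4 * (pi / 7)) = 2 * (2 * s * c) * (2 * c\<^sup>2 - 1)"
    using sin_double[of "2 * (pi / 7)"] sin_double[of "pi/7"] cos_double_cos[of "pi / 7"]
    by (simp add: c_def s_def)
  moreover have "sin (3 * (pi / 7)) = s * (4 * c\<^sup>2 - 1)"
  proof -
    have "sin (3 * (pi / 7)) = sin (2 * (pi / 7) + pi / 7)" by (simp add: field_simps)
    also have "\<dots> = (2 * s * c) * c + (2 * c\<^sup>2 - 1) * s"
      by (simp only: sin_add sin_double cos_double_cos c_def s_def)
    finally show ?thesis by (simp add: algebra_simps power2_eq_square)
  qed
  ultimately have "s * (4 * c * (2 * c\<^sup>2 - 1)) = s * (4 * c\<^sup>2 - 1)" by (simp add: algebra_simps)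
  then have eq: "4 * c * (2 * c\<^sup>2 - 1) = 4 * c\<^sup>2 - 1" using s0 by simp
  have "4 / 5 < c\<^sup>2"
  proof (rule ccontr)
    assume "\<not> 4 / 5 < c\<^sup>2"
    then have le: "c\<^sup>2 \<le> 4 / 5" by simp
    have "c \<le> 9 / 10" using le by (intro power2_le_imp_le[of c "9/10"]) (auto simp: power2_eq_square)
    have f: "8 * c * c\<^sup>2 - 4 * c\<^sup>2 - 4 * c + 1 = 0" using eq by (simp add: algebra_simps)
    \<comment> \<open>The cubic in factored form up to a constant; under the assumption the left
      side is at most \<open>8 / 10 * (6 / 5) < 1\<close>.\<close>
    have "(2 * c - 1) * (4 * c\<^sup>2 - 2) = 1" using f by (simp add: algebra_simps)
    moreover have "(2 * c - 1) * (4 * c\<^sup>2 - 2) \<le> (2 * c - 1) * (6 / 5)"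
      using le ch by (intro mult_left_mono) auto
    ultimately show False using \<open>c \<le> 9 / 10\<close> by simp
  qed
  then have "4 * s\<^sup>2 < c\<^sup>2" using cs by simp
  then have "(2 * s)\<^sup>2 < c\<^sup>2" by (simp add: power_mult_distrib)
  then have "2 * s < c" using ch by (intro power2_less_imp_less[of "2 * s" c]) auto
  then show ?thesis using ch unfolding tan_def c_def[symmetric] s_def[symmetric] by (simp add: field_simps)
qed

text \<open>The \<open>F\<close> of the idea: \<open>bis N j\<close> is a unit vector, so the inner
  product and \<open>cross2\<close> give the coordinates of \<open>d\<close> along and across the
  bisector.\<close>

definition cone_bound :: "real \<Rightarrow> real \<Rightarrow> nat \<Rightarrow> nat \<Rightarrow> pt \<Rightarrow> real" where
  "cone_bound h c N j d = (1 / cos h + c * tan h) * (d \<bullet> bis N j) + c * \<bar>cross2 d (bis N j)\<bar>"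

text \<open>Moving on by \<open>j\<close> cones rotates the coordinates by
  \<open>real j * theta N\<close>. The sign \<open>sg\<close> chooses clockwise or counterclockwise
  and mirrors the across coordinate to match, so one argument serves both sides. The index wraps
  around modulo \<open>N\<close>, which changes the angle by a multiple of
  \<open>2 * pi\<close>.\<close>

lemma bis_shift:
  assumes "N > 0" "sg = 1 \<or> sg = (-1::int)"
  obtains j' where "j' < N"
    "\<And>d. d \<bullet> bis N j' = (d \<bullet> bis N i) * cos (real j * theta N)
        + (of_int sg * cross2 d (bis N i)) * sin (real j * theta N)"
    "\<And>d. \<bar>cross2 d (bis N j')\<bar> = \<bar>(of_int sg * cross2 d (bis N i)) * cos (real j * theta N)
        - (d \<bullet> bis N i) * sin (real j * theta N)\<bar>"
proof
  define m where "m = int i + sg * int j"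
  define j' where "j' = nat (m mod int N)"
  show "j' < N" using assms by (simp add: j'_def nat_less_iff)
  have "real j' = of_int (m mod int N)" using assms by (simp add: j'_def)
  also have "\<dots> = of_int m - of_int (m div int N) * real N"
    by (simp add: minus_div_mult_eq_mod[symmetric])
  finally have j': "real j' = of_int m - of_int (m div int N) * real N" .
  have "real j' * theta N = of_int m * theta N - of_int (m div int N) * (2 * pi)"
    unfolding j' using assms by (simp add: theta_def field_simps)
  then have r: "real j' * theta N = (real i * theta N + of_int sg * (real j * theta N)) - of_int (m div int N) * (2 * pi)"
    by (simp add: m_def algebra_simps)
  have s: "sin (real j' * theta N) = sin (real i * theta N + of_int sg * (real j * theta N))"
    and c: "cos (real j' * theta N) = cos (real i * theta N + of_int sg * (real j * theta N))"
    unfolding r using sin_diff[of _ "of_int (m div int N) * (2 * pi)"] cos_diff[of _ "of_int (m div int N) * (2 * pi)"]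
    by (auto simp: mult.commute[of "of_int _" "2 * pi"] sin_int_2pin cos_int_2pin)
  have b: "bis N j' = (sin (real i * theta N + of_int sg * (real j * theta N)), cos (real i * theta N + of_int sg * (real j * theta N)))"
    unfolding bis_def s c ..
  show "d \<bullet> bis N j' = (d \<bullet> bis N i) * cos (real j * theta N)
        + (of_int sg * cross2 d (bis N i)) * sin (real j * theta N)" for d
    using assms(2) by (auto simp: b bis_def[of N i] cross2_def inner_prod_def sin_add cos_add sin_diff cos_diff algebra_simps)
  show "\<bar>cross2 d (bis N j')\<bar> = \<bar>(of_int sg * cross2 d (bis N i)) * cos (real j * theta N)
        - (d \<bullet> bis N i) * sin (real j * theta N)\<bar>" for d
  proof -
    have "cross2 d (bis N j') = of_int sg * ((of_int sg * cross2 d (bis N i)) * cos (real j * theta N)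
        - (d \<bullet> bis N i) * sin (real j * theta N))"
      using assms(2) by (auto simp: b bis_def[of N i] cross2_def inner_prod_def sin_add cos_add sin_diff cos_diff algebra_simps)
    then show ?thesis using assms(2) by (auto simp: abs_mult)
  qed
qed

lemma norm_bis_coords: "(norm d)\<^sup>2 = (d \<bullet> bis N i)\<^sup>2 + (cross2 d (bis N i))\<^sup>2"
proof -
  define s c where "s = sin (real i * theta N)" and "c = cos (real i * theta N)"
  have "s\<^sup>2 + c\<^sup>2 = 1" by (simp add: s_def c_def)
  then have "(fst d * s + snd d * c)\<^sup>2 + (fst d * c - snd d * s)\<^sup>2 = (fst d)\<^sup>2 + (snd d)\<^sup>2"
    by algebra
  then show ?thesis by (simp add: norm_prod_def bis_def cross2_def inner_prod_def s_def c_def)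
qed

lemma in_cone_iff:
  assumes "0 < cos (theta N / 2)" "0 < sin (theta N / 2)"
  shows "in_cone N i u v \<longleftrightarrow> i < N \<and> v \<noteq> u \<and> 0 < (v - u) \<bullet> bis N i \<and>
    \<bar>cross2 (v - u) (bis N i)\<bar> \<le> tan (theta N / 2) * ((v - u) \<bullet> bis N i)"
proof (cases "v = u")
  case False
  define y x c s where "y = (v - u) \<bullet> bis N i" and "x = cross2 (v - u) (bis N i)"
    and "c = cos (theta N / 2)" and "s = sin (theta N / 2)"
  have c: "c > 0" "s > 0" "c\<^sup>2 + s\<^sup>2 = 1" using assms by (auto simp: c_def s_def)
  have n: "(norm (v - u))\<^sup>2 = y\<^sup>2 + x\<^sup>2" using norm_bis_coords unfolding y_def x_def by blast
  have np: "norm (v - u) > 0" using False by simp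
  have t: "tan (theta N / 2) = s / c" by (simp add: tan_def c_def s_def)
  \<comment> \<open>Squaring removes the norm; it is reversible because the left side is positive,
    which also forces \<open>0 < y\<close>.\<close>
  have "norm (v - u) * c \<le> y \<longleftrightarrow> 0 < y \<and> (norm (v - u) * c)\<^sup>2 \<le> y\<^sup>2"
    using mult_pos_pos[OF np c(1)] power2_le_imp_le[of "norm (v - u) * c" y] power_mono[of "norm (v - u) * c" y 2]
    by (auto intro: less_le_trans)
  also have "(norm (v - u) * c)\<^sup>2 \<le> y\<^sup>2 \<longleftrightarrow> (y\<^sup>2 + x\<^sup>2) * c\<^sup>2 \<le> y\<^sup>2 * (c\<^sup>2 + s\<^sup>2)"
    using c n by (simp add: power_mult_distrib)
  also have "\<dots> \<longleftrightarrow> (x * c)\<^sup>2 \<le> (s * y)\<^sup>2" by (simp add: power_mult_distrib algebra_simps)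
  also have "(x * c)\<^sup>2 \<le> (s * y)\<^sup>2 \<longleftrightarrow> \<bar>x\<bar> * c \<le> s * \<bar>y\<bar>"
    using c by (simp only: abs_le_square_iff[symmetric] abs_mult abs_of_pos)
  also have "0 < y \<and> \<dots> \<longleftrightarrow> 0 < y \<and> \<bar>x\<bar> \<le> s / c * y"
    using c by (auto simp: field_simps)
  finally show ?thesis using False unfolding in_cone_def t y_def[symmetric] x_def[symmetric] c_def[symmetric]
    by auto
qed (simp add: in_cone_def)

lemma theta_bounds:
  assumes "N \<ge> 7"
  shows "0 < theta N" "theta N \<le> 2 * pi / 7"
    "0 < sin (theta N / 2)" "0 < cos (theta N / 2)" "0 < tan (theta N / 2)" "2 * tan (theta N / 2) < 1"
proof -
  show t: "0 < theta N" using assms by (simp add: theta_def)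
  show t7: "theta N \<le> 2 * pi / 7" using assms unfolding theta_def by (intro divide_left_mono) auto
  show "0 < sin (theta N / 2)" using t t7 pi_gt_zero by (intro sin_gt_zero) linarith+
  show "0 < cos (theta N / 2)" using t t7 pi_gt_zero by (intro cos_gt_zero_pi) linarith+
  show "0 < tan (theta N / 2)" using t t7 pi_gt_zero by (intro tan_gt_zero) linarith+
  have "tan (theta N / 2) \<le> tan (pi / 7)" using t t7 pi_gt_zero by (intro tan_mono_le) linarith+
  then show "2 * tan (theta N / 2) < 1" using tan_pi_div_7_less_half by linarith
qed

section \<open>The angle \<open>M\<close> behind the constant \<open>c\<close>\<close>

definition turn_limit :: "nat \<Rightarrow> nat \<Rightarrow> real" where
  "turn_limit N x = (if x = 4 then pi / 4 else pi / 4 + theta N / 8)"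

text \<open>Both closed forms equal \<open>sin M / cos (M + t / 2)\<close>. For \<open>x = 4\<close>
  this is the addition formula at \<open>pi / 4\<close>; otherwise the fraction is expanded by
  \<open>2 * cos M\<close>, and \<open>2 * M = pi / 2 + t / 4\<close> turns sines and cosines into
  each other.\<close>

lemma cconst_turn_limit:
  assumes "N \<ge> 7"
  shows "cconst N x * cos (turn_limit N x + theta N / 2) = sin (turn_limit N x)" "1 \<le> cconst N x"
proof -
  note t = theta_bounds[OF assms]
  define t where "t = theta N"
  have t1: "0 < t" "t \<le> 2 * pi / 7" using t by (auto simp: t_def)
  have "cconst N x * cos (turn_limit N x + t / 2) = sin (turn_limit N x) \<and> 1 \<le> cconst N x"
  proof (cases "x = 4")
    case True
    have "sin (t / 2) < cos (t / 2)"
      using sin_monotone_2pi[of "t / 2" "pi / 2 - t / 2"] t1 pi_gt_zero by (simp add: sin_diff)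
    moreover have "cos (t / 2) - sin (t / 2) \<le> 1" using t cos_le_one[of "t / 2"] by (auto simp: t_def simp del: cos_le_one)
    moreover have "cos (pi / 4 + t / 2) = sqrt 2 / 2 * (cos (t / 2) - sin (t / 2))"
      by (simp add: cos_add cos_45 sin_45 algebra_simps)
    ultimately have "1 / (cos (t / 2) - sin (t / 2)) * cos (pi / 4 + t / 2) = sqrt 2 / 2"
      "1 \<le> 1 / (cos (t / 2) - sin (t / 2))" by (simp_all add: le_divide_eq)
    then show ?thesis using True unfolding cconst_def turn_limit_def t_def by (simp add: sin_45)
  next
    case False
    define M where "M = pi / 4 + t / 8"
    have p: "sin (3 * t / 4) < cos (t / 2)"
      using sin_monotone_2pi[of "3 * t / 4" "pi / 2 - t / 2"] t1 pi_gt_zero by (simp add: sin_diff)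
    have "0 < sin (3 * t / 4)" using t1 pi_gt_zero by (intro sin_gt_zero) linarith+
    moreover have "cos (t / 2) \<le> cos (t / 4)" using t1 pi_gt_zero by (intro cos_monotone_0_pi_le) linarith+
    ultimately have 1: "1 \<le> cos (t / 4) / (cos (t / 2) - sin (3 * t / 4))" using p by (simp add: field_simps)
    have M0: "0 < cos M" unfolding M_def using t1 pi_gt_zero by (intro cos_gt_zero_pi) linarith+
    have "M + M = pi / 2 + t / 4" by (simp add: M_def)
    then have "cos (t / 4) = sin (M + M)" by (simp add: sin_add)
    then have a: "cos (t / 4) = 2 * sin M * cos M" by (simp only: sin_add) simp
    have "cos (t / 2) - sin (3 * t / 4) = cos ((M + t / 2) - M) + cos ((M + t / 2) + M)"
    proof -
      have "(M + t / 2) + M = pi / 2 + 3 * t / 4" by (simp add: M_def)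
      then show ?thesis by (simp add: cos_add)
    qed
    also have "\<dots> = 2 * cos (M + t / 2) * cos M" by (simp only: cos_diff cos_add)
    finally have b: "cos (t / 2) - sin (3 * t / 4) = 2 * cos (M + t / 2) * cos M" .
    then have "0 < cos (M + t / 2)" using p M0 by (smt (verit) mult_nonpos_nonneg)
    then have "cos (t / 4) / (cos (t / 2) - sin (3 * t / 4)) * cos (M + t / 2) = sin M"
      unfolding a b using M0 by simp
    then show ?thesis using False 1 by (simp add: cconst_def turn_limit_def t_def M_def)
  qed
  then show "cconst N x * cos (turn_limit N x + theta N / 2) = sin (turn_limit N x)" "1 \<le> cconst N x"
    by (auto simp: t_def)
qed

section \<open>The cost of a single chain edge\<close>

text \<open>After clearing denominators the claim reads
  \<open>c (sin (\<phi> + h) - sin (\<bar>\<psi>\<bar> + h)) \<ge> cos \<psi> - cos \<phi>\<close>; the prosthaphaeresis formulas turn it into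
  \<open>c cos (s + h) \<ge> sin s\<close> with \<open>s = (\<phi> + \<bar>\<psi>\<bar>) / 2\<close>.\<close>
lemma polar_cone_bound_le:
  fixes c h M \<phi> \<psi> :: real
  assumes h: "0 < cos h" and c: "c * cos (M + h) = sin M" and pos: "0 < cos (M + h)"
    and s: "\<phi> + \<bar>\<psi>\<bar> \<le> 2 * M" "\<bar>\<psi>\<bar> \<le> \<phi>" "\<phi> \<le> pi" "2 * M \<le> 2 * pi"
  shows "(1 / cos h + c * tan h) * cos \<psi> + c * \<bar>sin \<psi>\<bar> \<le> (1 / cos h + c * tan h) * cos \<phi> + c * sin \<phi>"
proof -
  define q s where "q = \<bar>\<psi>\<bar>" and "s = \<phi> / 2 + q / 2"
  have q: "0 \<le> q" "q \<le> pi" using s by (auto simp: q_def)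
  have "\<bar>sin \<psi>\<bar> = sin q" "cos \<psi> = cos q"
    using sin_ge_zero[of q] q by (auto simp: q_def abs_if split: if_splits)
  moreover have "0 \<le> sin ((\<phi> - q) / 2)" using s q by (intro sin_ge_zero) (auto simp: q_def)
  moreover have "sin s \<le> c * cos (s + h)"
  proof -
    \<comment> \<open>This identity shows why \<open>s \<le> M\<close> suffices: equality holds at
      \<open>s = M\<close>, and the difference has the sign of \<open>sin (M - s)\<close>.\<close>
    have "sin M * cos (s + h) - sin s * cos (M + h) = cos h * sin (M - s)"
      by (simp add: cos_add sin_diff algebra_simps)
    moreover have "0 \<le> M - s" "M - s \<le> pi" using s q by (simp_all add: s_def q_def[symmetric])
    then have "0 \<le> sin (M - s)" by (rule sin_ge_zero)
    ultimately have "sin s * cos (M + h) \<le> sin M * cos (s + h)" using h by (smt (verit) mult_nonneg_nonneg)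
    also have "\<dots> = c * cos (s + h) * cos (M + h)" using c by (simp add: algebra_simps)
    finally show ?thesis using pos by simp
  qed
  ultimately have "2 * sin s * sin ((\<phi> - q) / 2) \<le> 2 * (c * cos (s + h)) * sin ((\<phi> - q) / 2)"
    by (intro mult_right_mono) auto
  moreover have "2 * sin s * sin ((\<phi> - q) / 2) = cos q - cos \<phi>"
    using cos_diff_cos[of q \<phi>] by (simp add: s_def add_divide_distrib add.commute)
  moreover have "2 * cos (s + h) * sin ((\<phi> - q) / 2) = sin (\<phi> + h) - sin (q + h)"
  proof -
    have "((\<phi> + h) - (q + h)) / 2 = (\<phi> - q) / 2" "((\<phi> + h) + (q + h)) / 2 = s + h"
      by (auto simp: s_def field_simps)
    then show ?thesis using sin_diff_sin[of "\<phi> + h" "q + h"] by (simp only:) simp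
  qed
  moreover have "2 * (c * cos (s + h)) * sin ((\<phi> - q) / 2) = c * (2 * cos (s + h) * sin ((\<phi> - q) / 2))" by simp
  ultimately have "cos q - cos \<phi> \<le> c * (sin (\<phi> + h) - sin (q + h))" by simp
  then have "((1 + c * sin h) * cos q + c * sin q * cos h) / cos h
      \<le> ((1 + c * sin h) * cos \<phi> + c * sin \<phi> * cos h) / cos h"
    using h by (intro divide_right_mono) (auto simp: sin_add algebra_simps)
  moreover have "((1 + c * sin h) * C + c * D * cos h) / cos h = (1 / cos h + c * tan h) * C + c * D" for C D
    using h by (simp add: tan_def field_simps)
  ultimately show ?thesis using \<open>\<bar>sin \<psi>\<bar> = sin q\<close> \<open>cos \<psi> = cos q\<close> by simp
qed

text \<open>Here \<open>j\<close> is \<open>\<phi> / theta N\<close> rounded to the nearest integer,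
  so that bisector \<open>j\<close> is within half a cone of the direction \<open>\<phi>\<close>.
  The sum \<open>\<phi> + \<bar>\<phi> - real j * theta N\<bar>\<close> is either
  \<open>real j * theta N\<close> or \<open>2 * \<phi> - real j * theta N\<close>, depending on the
  side on which the bisector lies.\<close>

lemma nearest_cone:
  fixes k x N :: nat
  assumes N: "N = 4 * k + x" "x \<in> {3, 4, 5}" "k \<ge> 1" and \<phi>: "theta N / 2 \<le> \<phi>" "\<phi> < pi / 2"
  obtains j :: nat where "1 \<le> j" "\<bar>\<phi> - real j * theta N\<bar> \<le> theta N / 2"
    "\<phi> + \<bar>\<phi> - real j * theta N\<bar> \<le> 2 * turn_limit N x" "real j * theta N \<le> 2 * turn_limit N x"
proof -
  have N7: "N \<ge> 7" using N by auto
  note th = theta_bounds[OF N7]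
  define t where "t = \<phi> / theta N"
  have \<phi>t: "\<phi> = t * theta N" using th by (simp add: t_def)
  have pit: "pi = real N / 2 * theta N" using N7 by (simp add: theta_def)
  have t: "1 / 2 \<le> t" "t < real N / 4"
  proof -
    show "1 / 2 \<le> t" using \<phi>(1) th unfolding t_def by (simp add: field_simps)
    have "t * theta N < real N / 4 * theta N" using \<phi>(2) pit unfolding \<phi>t by simp
    then show "t < real N / 4" using th by simp
  qed
  define j where "j = nat \<lfloor>t + 1 / 2\<rfloor>"
  have j: "real j \<le> t + 1 / 2" "t + 1 / 2 < real j + 1" "1 \<le> j"
  proof -
    have "1 \<le> \<lfloor>t + 1 / 2\<rfloor>" using t by (simp add: le_floor_iff)
    moreover from this have "real j = of_int \<lfloor>t + 1 / 2\<rfloor>" by (simp add: j_def)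
    ultimately show "real j \<le> t + 1 / 2" "t + 1 / 2 < real j + 1" "1 \<le> j" by (auto simp: j_def) linarith+
  qed
  \<comment> \<open>The number \<open>e\<close> makes \<open>2 * turn_limit N x\<close> equal to
    \<open>(N + e) / 4\<close> cone angles for even and odd \<open>N\<close> alike.\<close>
  define e :: real where "e = (if x = 4 then 0 else 1)"
  have M: "2 * turn_limit N x = (real N / 4 + e / 4) * theta N"
    unfolding turn_limit_def e_def using pit by (simp add: algebra_simps)
  have "real j < real k + 7 / 4" using j t N by auto
  then have jk: "j \<le> k + 1" by linarith
  \<comment> \<open>For \<open>j \<le> k\<close> rounding bounds the sum by \<open>k + 1\<close>.
    For \<open>j = k + 1\<close> it is \<open>j\<close> or \<open>2 * t - j\<close>, and the latter
    is controlled by \<open>t < N / 4\<close>, that is, by \<open>\<phi> < pi / 2\<close>.\<close>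
  have *: "t + \<bar>t - real j\<bar> \<le> (real N / 4 + e / 4) \<and> real j \<le> (real N / 4 + e / 4)"
  proof (cases "j \<le> k")
    case True
    then have "real j \<le> real k" by simp
    moreover have "real k + 1 \<le> (real N / 4 + e / 4)" using N by (auto simp: e_def field_simps)
    ultimately show ?thesis using j t by (intro conjI) linarith+
  next
    case False
    then have "real j = real k + 1" using jk by simp
    moreover have "real k + 1 \<le> (real N / 4 + e / 4)" "real N \<le> 4 * real k + 4 + e" using N by (auto simp: e_def field_simps)
    ultimately show ?thesis using j t by (intro conjI) linarith+
  qed
  have ab: "\<bar>\<phi> - real j * theta N\<bar> = \<bar>t - real j\<bar> * theta N"
    unfolding \<phi>t using th by (simp add: abs_mult flip: left_diff_distrib)
  show thesis
  proof (rule that[of j])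
    show "\<bar>\<phi> - real j * theta N\<bar> \<le> theta N / 2"
      unfolding ab using j th mult_right_mono[of "\<bar>t - real j\<bar>" "1/2" "theta N"] by linarith
    show "\<phi> + \<bar>\<phi> - real j * theta N\<bar> \<le> 2 * turn_limit N x"
      unfolding ab M using \<phi>t * th mult_right_mono[of "t + \<bar>t - real j\<bar>" "(real N / 4 + e / 4)" "theta N"]
      by (simp add: algebra_simps)
    show "real j * theta N \<le> 2 * turn_limit N x"
      unfolding M using * th by (intro mult_right_mono) auto
  qed (use j in auto)
qed

text \<open>An edge \<open>d\<close> of the chain, with \<open>X\<close> and \<open>Y\<close> its
  coordinates in the cone of \<open>u\<close> and \<open>V\<close> the height of its lower end, is
  moved to the nearest cone. The height there must stay below \<open>H\<close> for the induction to
  apply. An edge to the left is allowed only if it stays in cone \<open>i\<close>; edges to the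
  right may be arbitrarily flat within \<open>XV\<close>.\<close>

lemma edge_cone_bound:
  fixes k x N i :: nat and d :: pt and sg :: int
  assumes N: "N = 4 * k + x" "x \<in> {3, 4, 5}" "k \<ge> 1" and i: "i < N"
    and sg: "sg = 1 \<or> sg = -1"
    and X: "X = of_int sg * cross2 d (bis N i)" and Y: "Y = d \<bullet> bis N i"
    and Y0: "0 < Y" and X0: "0 \<le> X \<or> \<bar>X\<bar> \<le> tan (theta N / 2) * Y"
    and XV: "X \<le> tan (theta N / 2) * (Y + 2 * V)" and V: "0 < V" "Y + V \<le> H"
  shows "\<exists>j<N. norm d * cos (theta N / 2) \<le> d \<bullet> bis N j \<and> d \<bullet> bis N j < H \<and>
    cone_bound (theta N / 2) (cconst N x) N j d
      \<le> (1 / cos (theta N / 2) + cconst N x * tan (theta N / 2)) * Y + cconst N x * \<bar>X\<bar>"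
proof -
  have N7: "N \<ge> 7" using N by auto
  note th = theta_bounds[OF N7]
  define h where "h = theta N / 2"
  define T where "T = theta N"
  have T: "0 < T" "T \<le> 2 * pi / 7" "h = T / 2" using th by (auto simp: T_def h_def)
  have d0: "d \<noteq> 0" using Y0 Y by auto
  have absX: "\<bar>X\<bar> = \<bar>cross2 d (bis N i)\<bar>" using X sg by (auto simp: abs_mult)
  show ?thesis
  proof (cases "\<bar>X\<bar> \<le> tan h * Y")
    case True
    have "in_cone N i 0 d" using in_cone_iff[of N i 0 d] th i d0 Y0 Y True absX by (simp add: h_def)
    then have "norm d * cos h \<le> d \<bullet> bis N i" by (simp add: in_cone_def h_def)
    moreover have "d \<bullet> bis N i < H" using V Y by simp
    ultimately show ?thesis using i absX Y by (auto simp: cone_bound_def h_def)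
  next
    case False
    then have Xp: "0 \<le> X" "tan h * Y < X" using X0 by (auto simp: h_def)
    define \<phi> r where "\<phi> = arctan (X / Y)" and "r = norm d"
    have tp: "tan \<phi> = X / Y" by (simp add: \<phi>_def tan_arctan)
    have \<phi>1: "\<phi> < pi / 2" "0 \<le> \<phi>" using Xp Y0 arctan_ubound by (auto simp: \<phi>_def)
    have "tan h < tan \<phi>" using Xp Y0 unfolding tp by (simp add: field_simps)
    then have \<phi>2: "h < \<phi>"
      using \<phi>1 T pi_gt_zero by (subst (asm) tan_mono_lt_eq) linarith+
    have cp: "0 < cos \<phi>" using \<phi>1 by (intro cos_gt_zero_pi) auto
    have r0: "0 < r" using d0 by (simp add: r_def)
    have r2: "r\<^sup>2 = Y\<^sup>2 + X\<^sup>2" using norm_bis_coords[of d N i] absX unfolding r_def Y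
      by (metis power2_abs)
    have XY: "X * cos \<phi> = Y * sin \<phi>" using tp cp Y0 by (simp add: tan_def field_simps)
    have sc: "(sin \<phi>)\<^sup>2 + (cos \<phi>)\<^sup>2 = 1" by simp
    have "(r * cos \<phi>)\<^sup>2 = (Y * cos \<phi>)\<^sup>2 + (X * cos \<phi>)\<^sup>2"
      by (simp add: power_mult_distrib r2 distrib_right)
    also have "\<dots> = Y\<^sup>2 * ((sin \<phi>)\<^sup>2 + (cos \<phi>)\<^sup>2)"
      unfolding XY by (simp only: power_mult_distrib distrib_left add.commute)
    also have "\<dots> = Y\<^sup>2" unfolding sc by simp
    finally have "(r * cos \<phi>)\<^sup>2 = Y\<^sup>2" .
    then have Yr: "Y = r * cos \<phi>" using mult_pos_pos[OF r0 cp] Y0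
      by (smt (verit) power2_eq_iff)
    then have Xr: "X = r * sin \<phi>" using XY cp by simp
    obtain j where j: "1 \<le> j" "\<bar>\<phi> - real j * T\<bar> \<le> h"
        "\<phi> + \<bar>\<phi> - real j * T\<bar> \<le> 2 * turn_limit N x" "real j * T \<le> 2 * turn_limit N x"
      using nearest_cone[OF N less_imp_le[OF \<phi>2[unfolded h_def]] \<phi>1(1)] unfolding T_def h_def by metis
    define \<psi> where "\<psi> = \<phi> - real j * T"
    have M: "2 * turn_limit N x \<le> pi / 2 + T / 4" "pi / 4 \<le> turn_limit N x" using T
      by (auto simp: turn_limit_def T_def)
    obtain j' where j': "j' < N"
      "d \<bullet> bis N j' = Y * cos (real j * T) + X * sin (real j * T)"
      "\<bar>cross2 d (bis N j')\<bar> = \<bar>X * cos (real j * T) - Y * sin (real j * T)\<bar>"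
    proof -
      have "0 < N" using N7 by simp
      from bis_shift[OF this sg] show thesis using that unfolding X Y T_def by metis
    qed
    have dj1: "d \<bullet> bis N j' = r * cos \<psi>"
      unfolding j' Xr Yr \<psi>_def by (simp add: cos_diff algebra_simps)
    have "X * cos (real j * T) - Y * sin (real j * T) = r * sin \<psi>"
      unfolding Xr Yr \<psi>_def by (simp add: sin_diff algebra_simps)
    then have dj2: "\<bar>cross2 d (bis N j')\<bar> = r * \<bar>sin \<psi>\<bar>"
      unfolding j' using r0 by (simp add: abs_mult)
    note dj = dj1 dj2
    have "r * cos h \<le> r * cos \<psi>"
    proof -
      have "cos h \<le> cos \<bar>\<psi>\<bar>" using j(2) T pi_gt_zero unfolding \<psi>_def by (intro cos_monotone_0_pi_le) linarith+
      then show ?thesis using r0 by simp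
    qed
    moreover have "d \<bullet> bis N j' < H"
    proof -
      have jT: "T \<le> real j * T" "real j * T \<le> pi" using j T M by (auto)
      have s0: "0 \<le> sin (real j * T)" using jT T by (intro sin_ge_zero) linarith+
      have "X * sin (real j * T) \<le> tan h * (Y + 2 * V) * sin (real j * T)"
        using XV s0 by (intro mult_right_mono) (auto simp: h_def)
      also have "\<dots> \<le> tan h * Y * sin (real j * T) + 2 * tan h * V"
      proof -
        have "2 * tan h * V * sin (real j * T) \<le> 2 * tan h * V * 1"
          using th V by (intro mult_left_mono) (auto simp: h_def)
        then show ?thesis by (simp add: algebra_simps)
      qed
      finally have 1: "X * sin (real j * T) \<le> tan h * Y * sin (real j * T) + 2 * tan h * V" .
      \<comment> \<open>Here the number of cones matters: with at least seven, the extra width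
        \<open>2 * V\<close> permitted by \<open>XV\<close> costs less height than
        \<open>V\<close>.\<close>
      have "2 * tan h * V < V" using th V by (simp add: h_def)
      moreover have "Y * cos (real j * T) + tan h * Y * sin (real j * T) \<le> Y"
      proof -
        \<comment> \<open>The sum to be bounded is \<open>Y * cos (real j * T - h) / cos h\<close>,
          and \<open>j \<ge> 1\<close> gives \<open>real j * T - h \<ge> h\<close>.\<close>
        have "cos (real j * T - h) \<le> cos h" using jT T pi_gt_zero by (intro cos_monotone_0_pi_le) linarith+
        then have "Y * cos (real j * T - h) / cos h \<le> Y" using th Y0 by (simp add: h_def divide_le_eq)
        moreover have "Y * cos (real j * T - h) / cos h = Y * cos (real j * T) + tan h * Y * sin (real j * T)"
        proof -
          have "cos h \<noteq> 0" using th by (simp add: h_def)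
          then show ?thesis unfolding cos_diff tan_def by (simp add: field_simps)
        qed
        ultimately show ?thesis by simp
      qed
      ultimately show ?thesis using 1 V unfolding j'(2) by linarith
    qed
    moreover have "cone_bound h (cconst N x) N j' d \<le> (1 / cos h + cconst N x * tan h) * Y + cconst N x * \<bar>X\<bar>"
    proof -
      have "(1 / cos h + cconst N x * tan h) * cos \<psi> + cconst N x * \<bar>sin \<psi>\<bar>
          \<le> (1 / cos h + cconst N x * tan h) * cos \<phi> + cconst N x * sin \<phi>"
      proof (rule polar_cone_bound_le[where M = "turn_limit N x"])
        show "0 < cos (turn_limit N x + h)" using M T pi_gt_zero by (intro cos_gt_zero_pi) linarith+
        show "\<bar>\<psi>\<bar> \<le> \<phi>" using j(2) \<phi>2 unfolding \<psi>_def by linarith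
      qed (use th cconst_turn_limit[OF N7] j M T \<phi>1 in \<open>auto simp: h_def \<psi>_def\<close>)
      then have "r * ((1 / cos h + cconst N x * tan h) * cos \<psi> + cconst N x * \<bar>sin \<psi>\<bar>)
          \<le> r * ((1 / cos h + cconst N x * tan h) * cos \<phi> + cconst N x * sin \<phi>)"
        using r0 by (intro mult_left_mono) auto
      then show ?thesis using Xp unfolding cone_bound_def dj by (simp add: Xr Yr algebra_simps)
    qed
    ultimately show ?thesis using j'(1) unfolding dj(1) r_def[symmetric] h_def[symmetric]
      by (intro exI[of _ j'] conjI) (simp_all only: dj(1))
  qed
qed

section \<open>Visibility in a corner\<close>

lemma cross2_linear:
  "cross2 (a + b) c = cross2 a c + cross2 b c" "cross2 c (a + b) = cross2 c a + cross2 c b"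
  "cross2 (a - b) c = cross2 a c - cross2 b c" "cross2 c (a - b) = cross2 c a - cross2 c b"
  "cross2 (r *\<^sub>R a) c = r * cross2 a c" "cross2 c (r *\<^sub>R a) = r * cross2 c a"
  "cross2 a a = 0"
  by (auto simp: cross2_def algebra_simps)

lemma cross2_swap: "cross2 a b = - cross2 b a"
  by (simp add: cross2_def)

lemma orient_flip: "orient u w v = - orient u v w"
  unfolding orient_def by (rule cross2_swap)

text \<open>By Cramer's rule this is the coefficient of \<open>v - u\<close> when
  \<open>p - u\<close> is expressed by \<open>v - u\<close> and \<open>w - u\<close>; exchanging
  \<open>v\<close> and \<open>w\<close> gives the other coefficient.\<close>

definition acoord :: "pt \<Rightarrow> pt \<Rightarrow> pt \<Rightarrow> pt \<Rightarrow> real" where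
  "acoord u v w p = orient u p w / orient u v w"

lemma acoord_decomp:
  assumes "orient u v w \<noteq> 0"
  shows "p - u = acoord u v w p *\<^sub>R (v - u) + acoord u w v p *\<^sub>R (w - u)"
proof -
  have "orient u v w *\<^sub>R (p - u) = orient u p w *\<^sub>R (v - u) + orient u v p *\<^sub>R (w - u)"
    by (auto simp: prod_eq_iff orient_def cross2_def algebra_simps)
  then have "inverse (orient u v w) *\<^sub>R (orient u v w *\<^sub>R (p - u))
      = inverse (orient u v w) *\<^sub>R (orient u p w *\<^sub>R (v - u) + orient u v p *\<^sub>R (w - u))" by simp
  moreover have "acoord u w v p = orient u v p / orient u v w"
    unfolding acoord_def using orient_flip[of u p v] orient_flip[of u w v] by simp
  ultimately show ?thesis using assms by (simp add: acoord_def scaleR_add_right divide_inverse mult.commute)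
qed

lemma acoord_affine:
  "acoord u v w ((1 - t) *\<^sub>R p + t *\<^sub>R q) = (1 - t) * acoord u v w p + t * acoord u v w q"
  unfolding acoord_def orient_def by (simp add: cross2_def algebra_simps add_divide_distrib diff_divide_distrib)

lemma acoord_comb:
  assumes "orient u v w \<noteq> 0"
  shows "acoord u v w (u + a *\<^sub>R (v - u) + g *\<^sub>R (w - u)) = a"
    "acoord u w v (u + a *\<^sub>R (v - u) + g *\<^sub>R (w - u)) = g"
proof -
  have "orient u w v \<noteq> 0" using assms orient_flip[of u w v] by simp
  moreover have "orient u (u + a *\<^sub>R (v - u) + g *\<^sub>R (w - u)) w = a * orient u v w"
    "orient u (u + a *\<^sub>R (v - u) + g *\<^sub>R (w - u)) v = g * orient u w v"
    by (auto simp: orient_def cross2_def algebra_simps)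
  ultimately show "acoord u v w (u + a *\<^sub>R (v - u) + g *\<^sub>R (w - u)) = a"
    "acoord u w v (u + a *\<^sub>R (v - u) + g *\<^sub>R (w - u)) = g"
    using assms by (auto simp: acoord_def)
qed

lemma acoord_vertices:
  assumes "orient u v w \<noteq> 0"
  shows "acoord u v w u = 0" "acoord u v w v = 1" "acoord u v w w = 0"
  using assms by (auto simp: acoord_def orient_def cross2_def)

text \<open>The hypothesis \<open>first\<close> says that the segment meets the line
  \<open>u w\<close> on the half that starts at \<open>u\<close> towards \<open>w\<close>. The
  meeting point stays strictly on the side of \<open>u\<close> of the cutting line, and
  \<open>1 \<le> be\<close> places that line's intersection with \<open>u w\<close> no further away
  than \<open>w\<close>.\<close>

lemma segment_leaves_corner_aux:
  fixes u v w z c :: pt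
  assumes nd: "orient u v w \<noteq> 0"
    and z: "0 < acoord u v w z" "0 < acoord u w v z" "al * acoord u v w z + be * acoord u w v z \<le> 1"
    and c: "acoord u v w c < 0 \<or> acoord u w v c < 0" "al * acoord u v w c + be * acoord u w v c < 1"
    and ab: "1 \<le> be"
    and first: "acoord u w v z * acoord u v w c \<le> acoord u v w z * acoord u w v c"
  shows "\<exists>e \<in> open_segment z c. e = u \<or> e \<in> open_segment u w"
proof -
  define az gz ac gc where "az = acoord u v w z" and "gz = acoord u w v z"
    and "ac = acoord u v w c" and "gc = acoord u w v c"
  note defs = az_def[symmetric] gz_def[symmetric] ac_def[symmetric] gc_def[symmetric]
  note z = z[unfolded defs] and c = c[unfolded defs] and first = first[unfolded defs]
  have uw: "u \<noteq> w" using nd by (auto simp: orient_def cross2_def)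
  have ac0: "ac < 0"
  proof (rule ccontr)
    assume "\<not> ac < 0"
    then have "0 \<le> gz * ac" "az * gc < 0" using c z by (auto simp: mult_pos_neg)
    then show False using first by linarith
  qed
  have zc: "z \<noteq> c" using z ac0 unfolding az_def ac_def by auto
  define t where "t = az / (az - ac)"
  have t: "0 < t" "t < 1" using z ac0 by (auto simp: t_def field_simps)
  define e where "e = (1 - t) *\<^sub>R z + t *\<^sub>R c"
  have mem: "e \<in> open_segment z c" using t zc unfolding in_segment e_def by blast
  have ae: "acoord u v w e = 0"
  proof -
    have "(1 - t) * az + t * ac = az - t * (az - ac)" by (simp add: algebra_simps)
    also have "\<dots> = 0" using z ac0 by (simp add: t_def)
    finally show ?thesis unfolding e_def acoord_affine defs .
  qed
  define G where "G = acoord u w v e"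
  have G: "G = (1 - t) * gz + t * gc" unfolding G_def e_def acoord_affine defs ..
  have ta: "t * (az - ac) = az" using z ac0 by (simp add: t_def)
  have "G * (az - ac) = gz * (az - ac) + (t * (az - ac)) * (gc - gz)" unfolding G by (simp add: algebra_simps)
  also have "\<dots> = az * gc - gz * ac" unfolding ta by (simp add: algebra_simps)
  finally have "0 \<le> G * (az - ac)" using first by simp
  then have G0: "0 \<le> G" using z ac0 by (simp add: zero_le_mult_iff)
  have "be * G < 1"
  proof -
    have "be * G = (1 - t) * (al * az + be * gz) + t * (al * ac + be * gc) - al * acoord u v w e"
      unfolding G e_def acoord_affine defs by (simp add: algebra_simps)
    also have "\<dots> < (1 - t) * 1 + t * 1" unfolding ae
      using add_le_less_mono[OF mult_left_mono[OF z(3), of "1 - t"] mult_strict_left_mono[OF c(2), of t]] t by simp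
    finally show ?thesis by simp
  qed
  then have G1: "G < 1" using ab G0 by (smt (verit) mult_right_mono mult_cancel_right2)
  have "e - u = G *\<^sub>R (w - u)" using acoord_decomp[OF nd, of e] ae by (simp add: G_def)
  then have e: "e = (1 - G) *\<^sub>R u + G *\<^sub>R w" by (simp add: algebra_simps)
  show ?thesis
  proof (cases "G = 0")
    case True
    then show ?thesis using mem e by auto
  next
    case False
    then have "e \<in> open_segment u w" using G0 G1 uw e unfolding in_segment by (auto intro!: exI[of _ G])
    then show ?thesis using mem by blast
  qed
qed

text \<open>A segment that starts inside the angle at \<open>u\<close> and leaves it close to \<open>u\<close> must leave through
  \<open>u\<close> or one of the two sides.\<close>
lemma segment_leaves_corner:
  fixes u v w z c :: pt
  assumes nd: "orient u v w \<noteq> 0"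
    and z: "0 < acoord u v w z" "0 < acoord u w v z" "al * acoord u v w z + be * acoord u w v z \<le> 1"
    and c: "acoord u v w c < 0 \<or> acoord u w v c < 0" "al * acoord u v w c + be * acoord u w v c < 1"
    and ab: "1 \<le> al" "1 \<le> be"
  shows "\<exists>e \<in> open_segment z c. e = u \<or> e \<in> open_segment u v \<or> e \<in> open_segment u w"
proof (cases "acoord u w v z * acoord u v w c \<le> acoord u v w z * acoord u w v c")
  case True
  from segment_leaves_corner_aux[OF nd z c ab(2) True] show ?thesis by blast
next
  case False
  \<comment> \<open>Exchanging \<open>v\<close> and \<open>w\<close> reverses the inequality between
    the two products.\<close>
  have nd': "orient u w v \<noteq> 0" using nd orient_flip[of u w v] by simp
  have "\<exists>e \<in> open_segment z c. e = u \<or> e \<in> open_segment u v"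
    by (rule segment_leaves_corner_aux[OF nd', of z be al c]) (use z c ab False in \<open>auto simp: add.commute\<close>)
  then show ?thesis by blast
qed

section \<open>Constraints and blocked views\<close>

lemma crosses_commute: "crosses a b c d = crosses a b d c" "crosses a b c d = crosses b a c d"
  unfolding crosses_def by (simp_all add: open_segment_commute)

lemma is_constraint_commute: "is_constraint S a b = is_constraint S b a"
  unfolding is_constraint_def by blast

locale constrained_points =
  fixes N :: nat and P :: "pt set" and S :: "(pt \<times> pt) set"
  assumes N7: "N \<ge> 7" and finP: "finite P" and gp: "general_position N P" and valid: "valid_constraints P S"
begin

lemma not_collinear:
  assumes "a \<in> P" "b \<in> P" "c \<in> P" "a \<noteq> b" "a \<noteq> c" "b \<noteq> c"
  shows "orient a b c \<noteq> 0"
  using gp assms unfolding general_position_def by blast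

lemma constraint_points:
  assumes "is_constraint S c d" shows "c \<in> P" "d \<in> P" "c \<noteq> d"
  using assms valid unfolding is_constraint_def valid_constraints_def by auto

lemma visible_not_crosses:
  assumes "visible S a b" "is_constraint S c d" "crosses a b c d"
  shows "{a, b} = {c, d}"
proof (rule ccontr)
  assume ne: "{a, b} \<noteq> {c, d}"
  have cd: "(c, d) \<in> S \<or> (d, c) \<in> S" using assms(2) by (simp add: is_constraint_def)
  show False
  proof (cases "is_constraint S a b")
    case True
    then have ab: "(a, b) \<in> S \<or> (b, a) \<in> S" by (simp add: is_constraint_def)
    have v: "\<not> crosses p q r s" if "(p, q) \<in> S" "(r, s) \<in> S" "{p, q} \<noteq> {r, s}" for p q r s
      using valid that unfolding valid_constraints_def by fastforce
    have "crosses b a c d" "crosses a b d c" "crosses b a d c" using assms(3) crosses_commute by blast+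
    then show False using ab cd ne assms(3) v[of a b c d] v[of b a c d] v[of a b d c] v[of b a d c]
      by (auto simp: insert_commute)
  next
    case False
    moreover have "crosses a b d c" using assms(3) crosses_commute by blast
    ultimately show False using assms cd unfolding visible_def by blast
  qed
qed

text \<open>If no point other than \<open>u\<close> lies in the corner cut off from the angle at \<open>u\<close> by the line
  \<open>al * a + be * g = 1\<close>, then points of the corner see each other: a constraint that blocks the view
  would have to enter the corner through one of the two sides or through \<open>u\<close>.\<close>
lemma visible_in_corner:
  assumes P: "u \<in> P" "v \<in> P" "w \<in> P" "s \<in> P" "t \<in> P" "s \<noteq> t"
    and nd: "orient u v w \<noteq> 0" and vis: "visible S u v" "visible S u w"
    and nocons: "\<And>d. is_constraint S u d \<Longrightarrow> \<not> (0 < acoord u v w d \<and> 0 < acoord u w v d)"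
    and ab: "1 \<le> al" "1 \<le> be"
    and empty: "\<And>p. p \<in> P \<Longrightarrow> 0 \<le> acoord u v w p \<Longrightarrow> 0 \<le> acoord u w v p \<Longrightarrow>
       al * acoord u v w p + be * acoord u w v p < 1 \<Longrightarrow> p = u"
    and st: "al * acoord u v w s + be * acoord u w v s \<le> 1" "al * acoord u v w t + be * acoord u w v t \<le> 1"
      "0 \<le> acoord u v w s" "0 \<le> acoord u w v s" "0 \<le> acoord u v w t" "0 \<le> acoord u w v t"
      "0 < acoord u v w s + acoord u v w t" "0 < acoord u w v s + acoord u w v t"
  shows "visible S s t"
proof (rule ccontr)
  assume nv: "\<not> visible S s t"
  then have "\<not> is_constraint S s t" by (simp add: visible_def)
  define l where "l p = 1 - al * acoord u v w p - be * acoord u w v p" for p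
  have l_affine: "l ((1 - r) *\<^sub>R p + r *\<^sub>R q) = (1 - r) * l p + r * l q" for r p q
    unfolding l_def acoord_affine by (simp add: algebra_simps)
  have ls: "0 \<le> l s" "0 \<le> l t" using st by (auto simp: l_def)
  from nv obtain c0 d0 where "(c0, d0) \<in> S" "crosses s t c0 d0" unfolding visible_def by blast
  then have con0: "is_constraint S c0 d0" by (simp add: is_constraint_def)
  from \<open>crosses s t c0 d0\<close> obtain z where z: "z \<in> open_segment s t" "z \<in> open_segment c0 d0"
    unfolding crosses_def by blast
  from z(1) obtain r where r: "0 < r" "r < 1" "z = (1 - r) *\<^sub>R s + r *\<^sub>R t" by (auto simp: in_segment)
  have pos: "0 < (1 - r) * x + r * y" if "0 \<le> x" "0 \<le> y" "0 < x + y" for x y :: real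
    using that r by (smt (verit) mult_nonneg_nonneg mult_pos_pos)
  have az: "0 < acoord u v w z" "0 < acoord u w v z"
    unfolding r(3) acoord_affine using st by (auto intro!: pos)
  have lz: "0 \<le> l z" unfolding r(3) l_affine using ls r by simp
  have nd': "orient u w v \<noteq> 0" using nd orient_flip[of u w v] by simp
  \<comment> \<open>An endpoint \<open>c\<close> strictly on the side of \<open>u\<close> would be
    \<open>u\<close> itself or lie outside the angle. The first contradicts \<open>nocons\<close>.
    In the second the constraint leaves the corner at some \<open>e\<close>: either it coincides
    with \<open>u v\<close> or \<open>u w\<close>, although \<open>z\<close> is strictly inside the
    angle, or \<open>u\<close> is collinear with \<open>c\<close> and \<open>d\<close>.\<close>
  have side: "l c \<le> 0" if con: "is_constraint S c d" and zcd: "z \<in> open_segment c d" for c d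
  proof (rule ccontr)
    assume "\<not> l c \<le> 0"
    then have lc: "0 < l c" by simp
    note cd = constraint_points[OF con]
    from zcd obtain q where q: "0 < q" "q < 1" "z = (1 - q) *\<^sub>R c + q *\<^sub>R d" by (auto simp: in_segment)
    have "c \<noteq> u"
    proof
      assume "c = u"
      then have "acoord u v w z = q * acoord u v w d" "acoord u w v z = q * acoord u w v d"
        unfolding q(3) acoord_affine using acoord_vertices[OF nd] acoord_vertices[OF nd'] by auto
      then have "0 < acoord u v w d \<and> 0 < acoord u w v d" using az q by (simp add: zero_less_mult_iff)
      then show False using nocons con \<open>c = u\<close> by blast
    qed
    then have "\<not> (0 \<le> acoord u v w c \<and> 0 \<le> acoord u w v c)"
      using empty[OF cd(1)] lc by (auto simp: l_def)
    then have "\<exists>e \<in> open_segment z c. e = u \<or> e \<in> open_segment u v \<or> e \<in> open_segment u w"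
      by (intro segment_leaves_corner[OF nd, of z al be c]) (use az lz lc ab in \<open>auto simp: l_def\<close>)
    then obtain e where e: "e \<in> open_segment z c" "e = u \<or> e \<in> open_segment u v \<or> e \<in> open_segment u w" by blast
    have ecd: "e \<in> open_segment c d"
    proof -
      from e(1) obtain q' where q': "0 < q'" "q' < 1" "e = (1 - q') *\<^sub>R z + q' *\<^sub>R c" by (auto simp: in_segment)
      have "e = (1 - (1 - q') * q) *\<^sub>R c + ((1 - q') * q) *\<^sub>R d"
        unfolding q' q by (simp add: algebra_simps)
      moreover have "0 < (1 - q') * q" using q q' by simp
      moreover have "(1 - q') * q < 1" using mult_right_mono[of "1 - q'" 1 q] q q' by linarith
      ultimately show ?thesis using cd(3) unfolding in_segment by blast
    qed
    have cd_uv: "\<not> (e \<in> open_segment u p)" if "p = v \<or> p = w" for p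
    proof
      assume "e \<in> open_segment u p"
      then have "crosses u p c d" using ecd by (auto simp: crosses_def)
      then have "{u, p} = {c, d}" using visible_not_crosses[OF _ con] vis that by blast
      then have "d = u" "c = p" using \<open>c \<noteq> u\<close> by (auto simp: doubleton_eq_iff)
      then have "acoord u v w z = (1 - q) * acoord u v w p" "acoord u w v z = (1 - q) * acoord u w v p"
        unfolding q(3) acoord_affine using acoord_vertices[OF nd] acoord_vertices[OF nd'] by auto
      then show False using az that acoord_vertices[OF nd] acoord_vertices[OF nd'] by auto
    qed
    have "e \<noteq> u"
    proof
      assume "e = u"
      then have u: "u \<in> open_segment c d" using ecd by simp
      then have "u \<noteq> d" by (auto simp: open_segment_def)
      moreover obtain y where "u = (1 - y) *\<^sub>R c + y *\<^sub>R d" using u by (auto simp: in_segment)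
      then have "u - c = y *\<^sub>R (d - c)" by (simp add: algebra_simps)
      then have "orient c d u = 0" unfolding orient_def by (simp only: cross2_linear)
      ultimately show False using not_collinear[of c d u] cd P \<open>c \<noteq> u\<close> by auto
    qed
    then show False using e(2) cd_uv by blast
  qed
  \<comment> \<open>Since \<open>0 \<le> l z\<close> between the two ends, only the degenerate case
    remains: the constraint, and then also \<open>s\<close> and \<open>t\<close>, lie on the cutting
    line.\<close>
  have "l c0 \<le> 0" "l d0 \<le> 0"
    using side[OF con0 z(2)] side[of d0 c0] con0 z(2)
    by (auto simp: is_constraint_commute open_segment_commute)
  moreover from z(2) obtain q where q: "0 < q" "q < 1" "z = (1 - q) *\<^sub>R c0 + q *\<^sub>R d0" by (auto simp: in_segment)
  moreover have "(1 - q) * l c0 + q * l d0 = l z" unfolding q(3) l_affine ..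
  ultimately have l0: "l c0 = 0" "l d0 = 0" "l z = 0"
    using lz by (smt (verit) mult_pos_neg mult_nonneg_nonpos)+
  have "l s = 0" "l t = 0"
    using l0(3) ls r unfolding r(3) l_affine by (smt (verit) mult_pos_pos mult_nonneg_nonneg)+
  have line: "orient p1 p2 p3 = 0" if "l p1 = 0" "l p2 = 0" "l p3 = 0" for p1 p2 p3
  proof -
    define a g where "a p = acoord u v w p" and "g p = acoord u w v p" for p
    have "al * (a p2 - a p1) = - be * (g p2 - g p1)" "al * (a p3 - a p1) = - be * (g p3 - g p1)"
      using that by (simp_all add: l_def a_def g_def algebra_simps)
    then have "al * ((a p2 - a p1) * (g p3 - g p1) - (g p2 - g p1) * (a p3 - a p1)) = 0" by algebra
    then have 0: "(a p2 - a p1) * (g p3 - g p1) - (g p2 - g p1) * (a p3 - a p1) = 0" using ab by simp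
    have dec: "p - p1 = (a p - a p1) *\<^sub>R (v - u) + (g p - g p1) *\<^sub>R (w - u)" for p
    proof -
      have "p - p1 = (p - u) - (p1 - u)" by simp
      also have "\<dots> = (a p *\<^sub>R (v - u) + g p *\<^sub>R (w - u)) - (a p1 *\<^sub>R (v - u) + g p1 *\<^sub>R (w - u))"
        using acoord_decomp[OF nd, of p] acoord_decomp[OF nd, of p1] unfolding a_def g_def by (simp only:)
      finally show ?thesis by (simp add: algebra_simps)
    qed
    have "orient p1 p2 p3 = ((a p2 - a p1) * (g p3 - g p1) - (g p2 - g p1) * (a p3 - a p1)) * cross2 (v - u) (w - u)"
      unfolding orient_def dec[of p2] dec[of p3]
      by (simp only: cross2_linear(1,2,5,6,7) cross2_swap[of "w - u" "v - u"]) (simp add: algebra_simps)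
    then show ?thesis using 0 by simp
  qed
  note cd = constraint_points[OF con0]
  \<comment> \<open>No three points are collinear, so \<open>s\<close> and \<open>t\<close> are the
    ends of the constraint and see each other along it.\<close>
  have in2: "p \<in> {c0, d0}" if "p \<in> P" "l p = 0" for p
    using not_collinear[of c0 d0 p] line[of c0 d0 p] cd that l0 by auto
  have "{s, t} = {c0, d0}" using in2[of s] in2[of t] P \<open>l s = 0\<close> \<open>l t = 0\<close> by auto
  then have "is_constraint S s t" using con0 is_constraint_commute[of S c0 d0] by (auto simp: doubleton_eq_iff)
  then show False using \<open>\<not> is_constraint S s t\<close> by blast
qed

end

section \<open>The convex chain\<close>

context constrained_points
begin

definition tri_pts :: "pt \<Rightarrow> pt \<Rightarrow> pt \<Rightarrow> pt set" where
  "tri_pts u v w = {q \<in> P. q \<noteq> u \<and> 0 \<le> acoord u v w q \<and> 0 \<le> acoord u w v q \<and>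
     acoord u v w q + acoord u w v q \<le> 1}"

lemma finite_tri_pts: "finite (tri_pts u v w)"
  using finP by (simp add: tri_pts_def)

lemma acoord_zero_collinear:
  assumes "u \<in> P" "w \<in> P" "q \<in> P" "orient u v w \<noteq> 0" "acoord u v w q = 0"
  shows "q = u \<or> q = w"
proof (rule ccontr)
  assume "\<not> ?thesis"
  moreover have "u \<noteq> w" using assms by (auto simp: orient_def cross2_def)
  ultimately have "orient u q w \<noteq> 0" using not_collinear[of u q w] assms by auto
  then show False using assms by (simp add: acoord_def)
qed

text \<open>The chain from \<open>v\<close> to \<open>w\<close> is the part of the convex hull of the points in the triangle
  \<open>u v w\<close> that faces \<open>u\<close>, found by gift wrapping: its next vertex after \<open>v\<close> is the point \<open>p\<close> for which
  \<open>v p\<close> makes the smallest angle with \<open>v u\<close>. Once the chain moves to the left (in \<open>x\<close>) it does so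
  until \<open>w\<close>, so that its total variation in \<open>x\<close> is \<open>2 m - x v - x w\<close> with \<open>m\<close> the maximum of \<open>x\<close>.\<close>
lemma chain_reach:
  fixes x y :: "pt \<Rightarrow> real" and A c \<tau> H m :: real
  assumes u: "u \<in> P"
    and lin: "\<And>a g p q r. p - u = a *\<^sub>R (q - u) + g *\<^sub>R (r - u) \<Longrightarrow> x p = a * x q + g * x r"
      "\<And>a g p q r. p - u = a *\<^sub>R (q - u) + g *\<^sub>R (r - u) \<Longrightarrow> y p = a * y q + g * y r"
    and c: "0 \<le> c" and \<tau>: "0 \<le> \<tau>"
    and edge: "\<And>s t. s \<in> P \<Longrightarrow> t \<in> P \<Longrightarrow> visible S s t \<Longrightarrow> 0 < y s \<Longrightarrow> \<bar>x s\<bar> \<le> \<tau> * y s \<Longrightarrow>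
       \<bar>x t\<bar> \<le> \<tau> * y t \<Longrightarrow> y s < y t \<Longrightarrow> y t \<le> H \<Longrightarrow>
       x s \<le> x t \<or> \<bar>x t - x s\<bar> \<le> \<tau> * (y t - y s) \<Longrightarrow>
       reach E s t (A * (y t - y s) + c * \<bar>x t - x s\<bar>)"
    and w: "w \<in> P" "visible S u w" "0 < y w" "\<bar>x w\<bar> \<le> \<tau> * y w" "y w \<le> H"
    and v: "v \<in> P" "orient u v w \<noteq> 0" "visible S u v" "0 < y v" "\<bar>x v\<bar> \<le> \<tau> * y v"
      "x v * y w < x w * y v"
    and nocons: "\<And>d. is_constraint S u d \<Longrightarrow> \<not> (0 < acoord u v w d \<and> 0 < acoord u w v d)"
    and low: "\<And>q. q \<in> tri_pts u v w \<Longrightarrow> q \<noteq> v \<Longrightarrow> y v < y q"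
    and m: "\<And>q. q \<in> tri_pts u v w \<Longrightarrow> x q \<le> m"
  shows "reach E v w (A * (y w - y v) + c * (2 * m - x v - x w))"
  using v nocons low m
proof (induction "card (tri_pts u v w)" arbitrary: v m rule: less_induct)
  case less
  note v = less.prems(1-6) and nocons = less.prems(7) and low = less.prems(8) and m = less.prems(9)
  note nd = v(2)
  have nd': "orient u w v \<noteq> 0" using nd orient_flip[of u w v] by simp
  define a g where "a q = acoord u v w q" and "g q = acoord u w v q" for q
  note avert = acoord_vertices[OF nd, folded a_def] acoord_vertices[OF nd', folded g_def]
  have dec: "q - u = a q *\<^sub>R (v - u) + g q *\<^sub>R (w - u)" for q
    unfolding a_def g_def by (rule acoord_decomp[OF nd])
  have xq: "x q = a q * x v + g q * x w" and yq: "y q = a q * y v + g q * y w" for q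
    using lin dec by blast+
  have uvw: "u \<noteq> v" "u \<noteq> w" "v \<noteq> w" using nd by (auto simp: orient_def cross2_def)
  have vT: "v \<in> tri_pts u v w" and wT: "w \<in> tri_pts u v w"
    using v(1) w(1) uvw avert by (auto simp: tri_pts_def a_def g_def)
  define Q where "Q = tri_pts u v w - {v}"
  have Qf: "finite Q" "w \<in> Q" using finite_tri_pts wT uvw by (auto simp: Q_def)
  have Qin: "q \<in> P" "q \<noteq> u" "0 \<le> a q" "0 < g q" "a q + g q \<le> 1" "a q < 1" if "q \<in> Q" for q
  proof -
    have 1: "q \<in> P" "q \<noteq> u" "q \<noteq> v" "0 \<le> a q" "0 \<le> g q" "a q + g q \<le> 1"
      using that by (auto simp: Q_def tri_pts_def a_def g_def)
    have "g q \<noteq> 0" using acoord_zero_collinear[OF u v(1) 1(1) nd'] 1 by (auto simp: g_def)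
    with 1 show "q \<in> P" "q \<noteq> u" "0 \<le> a q" "0 < g q" "a q + g q \<le> 1" "a q < 1" by auto
  qed
  \<comment> \<open>In the coordinates \<open>(a, g)\<close> the point \<open>v\<close> is
    \<open>(1, 0)\<close> and \<open>u\<close> is the origin, so \<open>f q\<close> is the slope of
    \<open>v q\<close> against \<open>v u\<close>.\<close>
  define f where "f q = g q / (1 - a q)" for q
  obtain p where p: "p \<in> Q" "\<And>q. q \<in> Q \<Longrightarrow> f p \<le> f q"
  proof -
    have "Q \<noteq> {}" using Qf by auto
    then show thesis using that[of "arg_min_on f Q"] arg_min_if_finite(1)[OF Qf(1), of f] arg_min_least[OF Qf(1), of _ f] by blast
  qed
  note pin = Qin[OF p(1)]
  have pmin: "g p * (1 - a q) \<le> g q * (1 - a p)" if "q \<in> Q" for q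
    using p(2)[OF that] Qin[OF that] pin by (simp add: f_def field_simps)
  \<comment> \<open>The line \<open>a + be * g = 1\<close> passes through \<open>v\<close> and
    \<open>p\<close>; by minimality of \<open>f p\<close> the corner it cuts off contains no point
    but \<open>u\<close>.\<close>
  define be where "be = (1 - a p) / g p"
  have be: "1 \<le> be" "be * g p = 1 - a p" using pin by (auto simp: be_def field_simps)
  have empty: "q = u" if "q \<in> P" "0 \<le> a q" "0 \<le> g q" "1 * a q + be * g q < 1" for q
  proof (rule ccontr)
    assume "q \<noteq> u"
    have "g q \<le> be * g q" using mult_right_mono[OF be(1) that(3)] by simp
    then have "a q + g q \<le> 1" "q \<noteq> v" using that avert by auto
    then have "q \<in> Q" using that \<open>q \<noteq> u\<close> by (auto simp: Q_def tri_pts_def a_def g_def)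
    from pmin[OF this] have "1 - a q \<le> be * g q" using pin by (simp add: be_def field_simps)
    then show False using that by simp
  qed
  have vis_corner: "visible S s p" if "s = v \<or> s = u \<and> 0 < a p" for s
  proof (rule visible_in_corner[OF u v(1) w(1) _ pin(1) _ nd v(3) w(2) nocons _ be(1)])
    show "s \<in> P" "s \<noteq> p" using that u v p(1) pin by (auto simp: Q_def)
    show "(1::real) \<le> 1" by simp
    show "q = u" if "q \<in> P" "0 \<le> acoord u v w q" "0 \<le> acoord u w v q" "1 * acoord u v w q + be * acoord u w v q < 1" for q
      using empty[of q] that by (simp add: a_def g_def)
  qed (use that pin avert be in \<open>auto simp: a_def[symmetric] g_def[symmetric]\<close>)
  have vp: "y v < y p" using low p(1) by (auto simp: Q_def)
  have vw: "y v < y w" using low wT uvw by auto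
  have yp: "y p \<le> y w"
  proof -
    have "y p \<le> a p * y w + g p * y w" unfolding yq[of p] using vw pin by (simp add: mult_left_mono)
    also have "\<dots> \<le> y w" using mult_right_mono[OF pin(5), of "y w"] w by (simp add: algebra_simps)
    finally show ?thesis .
  qed
  have xp: "\<bar>x p\<bar> \<le> \<tau> * y p"
  proof -
    have "\<bar>x p\<bar> \<le> a p * \<bar>x v\<bar> + g p * \<bar>x w\<bar>"
      unfolding xq[of p] using abs_triangle_ineq[of "a p * x v" "g p * x w"] pin by (simp add: abs_mult)
    also have "\<dots> \<le> a p * (\<tau> * y v) + g p * (\<tau> * y w)"
      using pin v w by (intro add_mono mult_left_mono) auto
    also have "\<dots> = \<tau> * y p" unfolding yq[of p] by (simp add: algebra_simps)
    finally show ?thesis .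
  qed
  \<comment> \<open>The direction from \<open>v\<close> to \<open>p\<close> is not further left than
    that from \<open>u\<close> to \<open>w\<close>, which lies in the cone; so a step to the left is
    no flatter than the boundary ray.\<close>
  have dir: "x v \<le> x p \<or> \<bar>x p - x v\<bar> \<le> \<tau> * (y p - y v)"
  proof (rule ccontr)
    assume neg: "\<not> ?thesis"
    have "(x p - x v) * y w - (y p - y v) * x w = (1 - a p) * (x w * y v - x v * y w)"
      unfolding xq[of p] yq[of p] by (simp add: algebra_simps)
    then have "0 \<le> (x p - x v) * y w - (y p - y v) * x w" using pin v by simp
    moreover have "(y p - y v) * - x w \<le> (y p - y v) * (\<tau> * y w)"
      using vp w by (intro mult_left_mono) auto
    ultimately have "(x v - x p) * y w \<le> (\<tau> * (y p - y v)) * y w" by (simp add: algebra_simps)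
    then have "x v - x p \<le> \<tau> * (y p - y v)" using w by simp
    then show False using neg by auto
  qed
  have e1: "reach E v p (A * (y p - y v) + c * \<bar>x p - x v\<bar>)"
    by (rule edge) (use v pin vis_corner vp xp yp w dir in auto)
  show ?case
  proof (cases "p = w")
    case True
    have "\<bar>x w - x v\<bar> \<le> 2 * m - x v - x w" using m[OF vT] m[OF wT] by auto
    then have "c * \<bar>x w - x v\<bar> \<le> c * (2 * m - x v - x w)" using c by (rule mult_left_mono)
    then show ?thesis using e1 True by (auto elim: reach_mono)
  next
    case False
    have ap: "0 < a p"
      using acoord_zero_collinear[OF u w(1) pin(1) nd] False pin by (force simp: a_def)
    have ndp: "orient u p w \<noteq> 0" using ap by (auto simp: a_def acoord_def)
    define s t where "s q = acoord u p w q" and "t q = acoord u w p q" for q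
    have decp: "q - u = s q *\<^sub>R (p - u) + t q *\<^sub>R (w - u)" for q
      unfolding s_def t_def by (rule acoord_decomp[OF ndp])
    have agq: "a q = s q * a p" "g q = s q * g p + t q" for q
    proof -
      have "q = u + (s q * a p) *\<^sub>R (v - u) + (s q * g p + t q) *\<^sub>R (w - u)"
        using decp[of q] unfolding dec[of p] by (simp add: algebra_simps)
      from arg_cong[OF this, of a] arg_cong[OF this, of g]
      show "a q = s q * a p" "g q = s q * g p + t q"
        unfolding a_def[of "u + _ + _"] g_def[of "u + _ + _"] acoord_comb[OF nd] .
    qed
    have Tp: "q \<in> P" "q \<noteq> u" "0 \<le> s q" "0 \<le> t q" "s q + t q \<le> 1" if "q \<in> tri_pts u p w" for q
      using that by (auto simp: tri_pts_def s_def t_def)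
    have sub: "q \<in> Q" if "q \<in> tri_pts u p w" for q
    proof -
      note q = Tp[OF that]
      have "s q * (a p + g p) \<le> s q * 1" using pin q by (intro mult_left_mono) auto
      then have "a q + g q \<le> 1" using q unfolding agq[of q] by (simp add: algebra_simps)
      moreover have "0 \<le> a q" "0 \<le> g q" using q pin ap unfolding agq[of q] by auto
      moreover have "q \<noteq> v"
      proof
        assume "q = v"
        then have "s q * a p = 1" using agq(1)[of v] avert by simp
        moreover have "s q * a p \<le> 1 * a p" using q ap by (intro mult_right_mono) auto
        ultimately show False using pin by simp
      qed
      ultimately show ?thesis using q by (auto simp: Q_def tri_pts_def a_def g_def)
    qed
    have "tri_pts u p w \<subset> tri_pts u v w" using sub vT unfolding Q_def by blast
    then have card: "card (tri_pts u p w) < card (tri_pts u v w)"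
      using finite_tri_pts by (rule psubset_card_mono[rotated])
    \<comment> \<open>Convexity of the chain: seen from \<open>p\<close>, every other point of the
      next triangle lies between the prolongations of \<open>v p\<close> and \<open>u p\<close>. The
      condition \<open>0 \<le> k\<close> is the minimality of \<open>f p\<close>.\<close>
    have beyond: "\<exists>l k. 0 < l \<and> 0 \<le> k \<and> y q - y p = l * (y p - y v) + k * y p \<and>
        x q - x p = l * (x p - x v) + k * x p" if "q \<in> tri_pts u p w" "q \<noteq> p" for q
    proof (intro exI conjI)
      note q = Tp[OF that(1)]
      define l k where "l = a p * t q / g p" and "k = s q - 1 + t q * (1 - a p) / g p"
      have "g p * (1 - s q * a p) \<le> (s q * g p + t q) * (1 - a p)"
        using pmin[OF sub[OF that(1)]] unfolding agq[of q] .
      then have "g p * (1 - s q) \<le> t q * (1 - a p)" by (simp add: algebra_simps)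
      then show k: "0 \<le> k" using pin by (simp add: k_def field_simps)
      have "t q \<noteq> 0"
      proof
        assume "t q = 0"
        then have "s q = 1" using k q by (simp add: k_def)
        then have "q - u = p - u" using decp[of q] \<open>t q = 0\<close> by simp
        then show False using that by simp
      qed
      then show "0 < l" using q ap pin by (simp add: l_def)
      have gen: "F q - F p = l * (F p - F v) + k * F p"
        if "F q = s q * F p + t q * F w" "F p = a p * F v + g p * F w" for F :: "pt \<Rightarrow> real"
      proof -
        define i where "i = inverse (g p)"
        have fw: "F w = (F p - a p * F v) * i" using that(2) pin by (simp add: i_def field_simps)
        show ?thesis unfolding that(1) fw l_def k_def divide_inverse i_def[symmetric] by (simp add: algebra_simps)
      qed
      show "y q - y p = l * (y p - y v) + k * y p" by (rule gen[OF lin(2)[OF decp] yq])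
      show "x q - x p = l * (x p - x v) + k * x p" by (rule gen[OF lin(1)[OF decp] xq])
    qed
    have nocons': "\<not> (0 < acoord u p w d \<and> 0 < acoord u w p d)" if "is_constraint S u d" for d
      using nocons[OF that] agq[of d] ap pin unfolding a_def[symmetric] g_def[symmetric] s_def[symmetric] t_def[symmetric]
      by (auto simp: add_pos_pos)
    have low': "y p < y q" if "q \<in> tri_pts u p w" "q \<noteq> p" for q
    proof -
      from beyond[OF that] obtain l k where lk: "0 < l" "0 \<le> k" "y q - y p = l * (y p - y v) + k * y p" by blast
      have "0 < l * (y p - y v)" "0 \<le> k * y p" using lk vp v by auto
      then show ?thesis using lk by linarith
    qed
    have left': "x p * y w < x w * y p"
    proof -
      have "x w * y p - x p * y w = a p * (x w * y v - x v * y w)"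
        unfolding xq[of p] yq[of p] by (simp add: algebra_simps)
      then show ?thesis using ap v by (smt (verit) mult_pos_pos)
    qed
    \<comment> \<open>The bound \<open>m'\<close> stays free: it becomes \<open>m\<close> while the
      chain goes right and \<open>x p\<close> once it goes left.\<close>
    have IH: "reach E p w (A * (y w - y p) + c * (2 * m' - x p - x w))"
      if "\<And>q. q \<in> tri_pts u p w \<Longrightarrow> x q \<le> m'" for m'
      by (rule less.hyps[OF card pin(1) ndp _ _ xp left' nocons' low' that])
         (use vis_corner ap vp v in auto)
    show ?thesis
    proof (cases "x v \<le> x p")
      case True
      have "reach E p w (A * (y w - y p) + c * (2 * m - x p - x w))"
        by (rule IH) (use sub m in \<open>auto simp: Q_def\<close>)
      from reach_trans[OF e1 this] show ?thesis by (rule reach_mono) (use True in \<open>simp add: algebra_simps\<close>)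
    next
      case False
      then have abs: "\<bar>x p - x v\<bar> = x v - x p" by simp
      \<comment> \<open>The point \<open>p\<close> is higher than \<open>v\<close> and to the right
        of the ray from \<open>u\<close> through \<open>v\<close>; with \<open>0 < x p\<close> it
        would also satisfy \<open>x v < x p\<close>.\<close>
      have "x p \<le> 0"
      proof (rule ccontr)
        assume xp0: "\<not> x p \<le> 0"
        have "x v * y p - x p * y v = g p * (x v * y w - x w * y v)"
          unfolding xq[of p] yq[of p] by (simp add: algebra_simps)
        then have "x v * y p < x p * y v" using pin v by (smt (verit) mult_pos_neg)
        also have "\<dots> \<le> x p * y p" using xp0 vp by simp
        finally show False using False vp v by simp
      qed
      \<comment> \<open>By \<open>beyond\<close> each later point arises from \<open>p\<close> by
        two displacements that do not go right, so \<open>x p\<close> is the new maximum and the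
        variation telescopes to \<open>x v - x w\<close>.\<close>
      have "x q \<le> x p" if "q \<in> tri_pts u p w" for q
      proof (cases "q = p")
        case False': False
        from beyond[OF that False'] obtain l k
          where lk: "0 < l" "0 \<le> k" "x q - x p = l * (x p - x v) + k * x p" by blast
        have "l * (x p - x v) \<le> 0" "k * x p \<le> 0" using lk False \<open>x p \<le> 0\<close>
          by (auto simp: mult_le_0_iff)
        then show ?thesis using lk by linarith
      qed simp
      then have "reach E p w (A * (y w - y p) + c * (2 * x p - x p - x w))" by (rule IH)
      from reach_trans[OF e1 this]
      have "reach E v w (A * (y w - y v) + c * (x v - x w))"
        by (rule reach_mono) (unfold abs, rule eq_refl, algebra)
      moreover have "c * (x v - x w) \<le> c * (2 * m - x v - x w)" using m[OF vT] c by (intro mult_left_mono) auto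
      ultimately show ?thesis by (auto elim: reach_mono)
    qed
  qed
qed

end

section \<open>Subcones\<close>

text \<open>The triangle inequality for the norm makes a cone convex; the positive height keeps
  \<open>d\<close> away from the apex.\<close>

lemma in_cone_comb:
  assumes v: "in_cone N i u v" and w: "in_cone N i u w" and N: "N \<ge> 7"
    and d: "d - u = a *\<^sub>R (v - u) + g *\<^sub>R (w - u)" and ag: "0 \<le> a" "0 \<le> g" "0 < a + g"
  shows "in_cone N i u d"
proof -
  note th = theta_bounds[OF N]
  have y: "0 < (v - u) \<bullet> bis N i" "0 < (w - u) \<bullet> bis N i"
    using v w in_cone_iff th by blast+
  have "0 < a * ((v - u) \<bullet> bis N i) + g * ((w - u) \<bullet> bis N i)"
    using y ag by (smt (verit) mult_nonneg_nonneg mult_pos_pos)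
  also have "\<dots> = (d - u) \<bullet> bis N i" unfolding d by (simp add: inner_add_left)
  finally have "d \<noteq> u" by auto
  moreover have "norm (d - u) * cos (theta N / 2) \<le> (d - u) \<bullet> bis N i"
  proof -
    have "norm (d - u) \<le> a * norm (v - u) + g * norm (w - u)"
      unfolding d using norm_triangle_ineq[of "a *\<^sub>R (v - u)" "g *\<^sub>R (w - u)"] ag by simp
    then have "norm (d - u) * cos (theta N / 2) \<le> (a * norm (v - u) + g * norm (w - u)) * cos (theta N / 2)"
      using th by (intro mult_right_mono) auto
    also have "\<dots> = a * (norm (v - u) * cos (theta N / 2)) + g * (norm (w - u) * cos (theta N / 2))"
      by (simp add: algebra_simps)
    also have "\<dots> \<le> a * ((v - u) \<bullet> bis N i) + g * ((w - u) \<bullet> bis N i)"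
      using v w ag unfolding in_cone_def by (intro add_mono mult_left_mono) auto
    also have "\<dots> = (d - u) \<bullet> bis N i" unfolding d by (simp add: inner_add_left)
    finally show ?thesis .
  qed
  ultimately show ?thesis using v by (simp add: in_cone_def)
qed

text \<open>The detour along the boundary ray on the side of negative \<open>x\<close>, then along
  the opposite side of the triangle, has length \<open>y / cos h + (tan h * y + x)\<close>;
  \<open>1 \<le> c\<close> does not shorten its second leg. The term \<open>c * x\<close> keeps its
  sign in order to cancel against \<open>chain_reach\<close>.\<close>

lemma norm_le_corner_path:
  fixes x y h :: real
  assumes "(norm d)\<^sup>2 = y\<^sup>2 + x\<^sup>2" "0 < y" "\<bar>x\<bar> \<le> tan h * y" "0 < cos h" "1 \<le> c"
  shows "norm d \<le> (1 / cos h + c * tan h) * y + c * x"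
proof -
  define K q where "K = y / cos h" and "q = tan h * y + x"
  have q: "0 \<le> q" using assms by (auto simp: q_def)
  have K0: "0 \<le> K" using assms by (simp add: K_def)
  have sec: "1 + (tan h)\<^sup>2 = (inverse (cos h))\<^sup>2" using assms by (intro tan_sec) auto
  have K2: "K\<^sup>2 = y\<^sup>2 + (tan h * y)\<^sup>2"
    unfolding K_def divide_inverse power_mult_distrib sec[symmetric] by (simp add: algebra_simps)
  have K1: "tan h * y \<le> K" by (rule power2_le_imp_le[OF _ K0]) (simp add: K2)
  have th: "0 \<le> tan h * y" using assms by auto
  have "(norm d)\<^sup>2 = K\<^sup>2 + q\<^sup>2 - 2 * (q * (tan h * y))"
    unfolding assms(1) K2 q_def by (simp add: power2_eq_square algebra_simps)
  also have "\<dots> \<le> K\<^sup>2 + q\<^sup>2 + 2 * (q * K)"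
    using mult_nonneg_nonneg[OF q th] mult_nonneg_nonneg[OF q K0] by linarith
  also have "\<dots> = (K + q)\<^sup>2" by (simp add: power2_eq_square algebra_simps)
  finally have "norm d \<le> K + q" using K0 q by (rule power2_le_imp_le[OF _ add_nonneg_nonneg])
  also have "\<dots> \<le> K + c * q" using q assms(5) mult_right_mono[of 1 c q] by simp
  also have "\<dots> = (1 / cos h + c * tan h) * y + c * x" by (simp add: K_def q_def algebra_simps)
  finally show ?thesis .
qed

lemma cross2_bis_coords:
  "cross2 v w = cross2 v (bis N i) * (w \<bullet> bis N i) - cross2 w (bis N i) * (v \<bullet> bis N i)"
proof -
  define s c where "s = sin (real i * theta N)" and "c = cos (real i * theta N)"
  have "s\<^sup>2 + c\<^sup>2 = 1" by (simp add: s_def c_def)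
  then have "fst v * snd w - snd v * fst w = (fst v * c - snd v * s) * (fst w * s + snd w * c)
      - (fst w * c - snd w * s) * (fst v * s + snd v * c)" by algebra
  then show ?thesis by (simp add: cross2_def bis_def inner_prod_def s_def c_def)
qed

context constrained_points
begin

text \<open>The vertex \<open>w\<close> may lie on a constraint ray of \<open>u\<close>, so it is
  pushed slightly along a boundary direction of the cone. By general position this direction is not
  parallel to \<open>u w\<close>, so the new point is off that line, while a small push crosses none
  of the lines from \<open>u\<close> through other vertices.\<close>

lemma subcone_ref_exists:
  assumes u: "u \<in> P" and w: "w \<in> P" and cone: "in_cone N i u w"
  obtains r where "subcone_ref S N i u r" "in_subcone S N i u r w"
proof -
  define rd where "rd = ray_dir N i"
  have iN: "i < N" and wu: "w \<noteq> u" using cone by (auto simp: in_cone_def)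
  have ndw: "cross2 (w - u) rd \<noteq> 0"
    using gp iN wu u w unfolding general_position_def rd_def by auto
  have sub: "(2 * real i + 1) * theta N / 2 - real i * theta N = theta N / 2" by (simp add: algebra_simps)
  have rdb: "rd \<bullet> bis N i = cos (theta N / 2)"
    using cos_diff[of "(2 * real i + 1) * theta N / 2" "real i * theta N"] unfolding sub
    by (simp add: rd_def ray_dir_def bis_def inner_prod_def algebra_simps)
  have rdn: "norm rd = 1" by (simp add: rd_def ray_dir_def norm_prod_def)
  have rdc: "in_cone N i u (u + rd)" using rdb rdn iN by (auto simp: in_cone_def)
  define K where "K = {v \<in> P. v \<noteq> u \<and> v \<noteq> w}"
  have "eventually (\<lambda>e. 0 < orient u v w * (orient u v w + e * cross2 (v - u) rd)) (at_right 0)"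
    if "v \<in> K" for v
  proof -
    have "((\<lambda>e. orient u v w * (orient u v w + e * cross2 (v - u) rd)) \<longlongrightarrow>
        orient u v w * (orient u v w + 0 * cross2 (v - u) rd)) (at_right 0)"
      by (intro tendsto_intros)
    moreover have "orient u v w \<noteq> 0" using not_collinear[of u v w] u w wu that by (auto simp: K_def)
    then have "0 < orient u v w * (orient u v w + 0 * cross2 (v - u) rd)"
      by (auto simp: zero_less_mult_iff linorder_neq_iff)
    ultimately show ?thesis by (rule order_tendstoD(1))
  qed
  then have "eventually (\<lambda>e. \<forall>v\<in>K. 0 < orient u v w * (orient u v w + e * cross2 (v - u) rd)) (at_right 0)"
    using finP by (intro eventually_ball_finite) (auto simp: K_def)
  then have "eventually (\<lambda>e. (\<forall>v\<in>K. 0 < orient u v w * (orient u v w + e * cross2 (v - u) rd)) \<and> 0 < e) (at_right 0)"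
    using eventually_at_right_less by (rule eventually_conj)
  then obtain e :: real where e: "0 < e" "\<And>v. v \<in> K \<Longrightarrow> 0 < orient u v w * (orient u v w + e * cross2 (v - u) rd)"
    using eventually_happens'[OF trivial_limit_at_right_real] by blast
  define r where "r = w + e *\<^sub>R rd"
  have rcone: "in_cone N i u r"
    by (rule in_cone_comb[OF cone rdc N7, of _ 1 e]) (use e in \<open>auto simp: r_def\<close>)
  have orv: "orient u v r = orient u v w + e * cross2 (v - u) rd" for v
  proof -
    have "r - u = (w - u) + e *\<^sub>R rd" by (simp add: r_def)
    then show ?thesis unfolding orient_def by (simp only: cross2_linear(2,6))
  qed
  have consP: "v \<in> P \<and> v \<noteq> u" if "cons_ray S N i u v" for v
    using that constraint_points[of u v] by (auto simp: cons_ray_def)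
  have wr: "orient u w w = 0" unfolding orient_def by (rule cross2_linear)
  have "subcone_ref S N i u r" unfolding subcone_ref_def
  proof (intro conjI allI impI)
    fix v assume "cons_ray S N i u v"
    then have v: "v \<in> P" "v \<noteq> u" using consP by auto
    show "orient u v r \<noteq> 0"
    proof (cases "v = w")
      case True
      then show ?thesis using orv[of w] wr e ndw by simp
    next
      case False
      then show ?thesis using e(2)[of v] v orv[of v] by (auto simp: K_def)
    qed
  qed (rule rcone)
  moreover have "in_subcone S N i u r w" unfolding in_subcone_def
  proof (intro conjI notI)
    assume "\<exists>v. cons_ray S N i u v \<and> orient u r v * orient u v w > 0"
    then obtain v where v: "cons_ray S N i u v" "orient u r v * orient u v w > 0" by blast
    then have "v \<noteq> w" using wr by auto
    then have "0 < orient u v w * orient u v r" using e(2)[of v] consP[OF v(1)] orv[of v] by (auto simp: K_def)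
    then show False using v(2) orient_flip[of u r v] by (simp add: mult.commute)
  qed (rule cone)
  ultimately show thesis by (rule that)
qed

text \<open>A constraint ray strictly inside the angle at \<open>u\<close> has \<open>v\<close> and
  \<open>w\<close> on opposite sides. As \<open>r\<close> is not on its line, the ray would separate
  \<open>r\<close> from one of them, against their membership in the subcone.\<close>

lemma subcone_no_constraint_between:
  assumes r: "subcone_ref S N i u r" and v: "in_subcone S N i u r v" and w: "in_subcone S N i u r w"
    and nd: "orient u v w \<noteq> 0" and con: "is_constraint S u d"
  shows "\<not> (0 < acoord u v w d \<and> 0 < acoord u w v d)"
proof
  assume pos: "0 < acoord u v w d \<and> 0 < acoord u w v d"
  have "in_cone N i u d"
    by (rule in_cone_comb[OF _ _ N7 acoord_decomp[OF nd, of d]]) (use v w pos in \<open>auto simp: in_subcone_def\<close>)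
  then have ray: "cons_ray S N i u d" using con by (simp add: cons_ray_def)
  define D where "D = orient u v w"
  have D: "D \<noteq> 0" "orient u w v = - D" using nd orient_flip[of u w v] by (auto simp: D_def)
  have od: "orient u d w = acoord u v w d * D" "orient u d v = - (acoord u w v d * D)"
    using D by (auto simp: acoord_def D_def)
  have "orient u d r \<noteq> 0" using r ray unfolding subcone_ref_def by blast
  then have rd: "orient u r d \<noteq> 0" using orient_flip[of u r d] by simp
  have "\<not> 0 < orient u r d * orient u d w" "\<not> 0 < orient u r d * orient u d v"
    using v w ray unfolding in_subcone_def by blast+
  then have "acoord u v w d * (orient u r d * D) \<le> 0" "0 \<le> acoord u w v d * (orient u r d * D)"
    unfolding od by (simp_all add: algebra_simps)
  then have "orient u r d * D \<le> 0" "0 \<le> orient u r d * D"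
    using pos by (simp_all add: mult_le_0_iff zero_le_mult_iff)
  then show False using D rd by simp
qed

lemma in_subcone_comb:
  assumes v: "in_subcone S N i u r v" and w: "in_subcone S N i u r w"
    and q: "q - u = a *\<^sub>R (v - u) + g *\<^sub>R (w - u)" and ag: "0 \<le> a" "0 \<le> g" "0 < a + g"
  shows "in_subcone S N i u r q"
  unfolding in_subcone_def
proof (intro conjI notI)
  show "in_cone N i u q"
    by (rule in_cone_comb[OF _ _ N7 q ag]) (use v w in \<open>auto simp: in_subcone_def\<close>)
  assume "\<exists>d. cons_ray S N i u d \<and> orient u r d * orient u d q > 0"
  then obtain d where d: "cons_ray S N i u d" "orient u r d * orient u d q > 0" by blast
  have "orient u d q = a * orient u d v + g * orient u d w"
    unfolding orient_def q by (simp only: cross2_linear(2,6))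
  then have "orient u r d * orient u d q = a * (orient u r d * orient u d v) + g * (orient u r d * orient u d w)"
    by (simp add: algebra_simps)
  moreover have "orient u r d * orient u d v \<le> 0" "orient u r d * orient u d w \<le> 0"
    using v w d(1) unfolding in_subcone_def by (meson not_le)+
  ultimately show False using d(2) ag by (smt (verit) mult_nonneg_nonpos)
qed

text \<open>If some point of the triangle were below \<open>v\<close>, the lowest one would be
  visible from \<open>u\<close>, because the corner below it is empty, and it would lie in the same
  subcone, against the choice of \<open>v\<close>. General position excludes equal heights.\<close>

lemma closest_lowest_in_triangle:
  assumes P: "u \<in> P" "v \<in> P" "w \<in> P" and nd: "orient u v w \<noteq> 0"
    and vis: "visible S u v" "visible S u w"
    and r: "subcone_ref S N i u r" and v: "in_subcone S N i u r v" and w: "in_subcone S N i u r w"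
    and closest: "\<And>q. q \<in> P \<Longrightarrow> in_subcone S N i u r q \<Longrightarrow> visible S u q \<Longrightarrow>
      (v - u) \<bullet> bis N i \<le> (q - u) \<bullet> bis N i"
    and q: "q \<in> tri_pts u v w" "q \<noteq> v"
  shows "(v - u) \<bullet> bis N i < (q - u) \<bullet> bis N i"
proof (rule ccontr)
  assume neg: "\<not> ?thesis"
  define y where "y p = (p - u) \<bullet> bis N i" for p
  note th = theta_bounds[OF N7]
  have iN: "i < N" using v by (simp add: in_subcone_def in_cone_def)
  have nd': "orient u w v \<noteq> 0" using nd orient_flip[of u w v] by simp
  have y0: "0 < y v" "0 < y w" using v w in_cone_iff[OF th(4,3)] by (auto simp: in_subcone_def y_def)
  have vw: "y v \<le> y w" using closest[OF P(3) w vis(2)] by (simp add: y_def)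
  have "q \<in> P" using q by (simp add: tri_pts_def)
  then have "(q - v) \<bullet> bis N i \<noteq> 0" using gp P(2) q(2) iN unfolding general_position_def by auto
  then have "y q \<noteq> y v" by (auto simp: y_def inner_diff_left)
  then have qv: "y q < y v" using neg by (simp add: y_def)
  define p where "p = arg_min_on y (tri_pts u v w)"
  have pT: "p \<in> tri_pts u v w" and pmin: "\<And>q. q \<in> tri_pts u v w \<Longrightarrow> y p \<le> y q"
    unfolding p_def using arg_min_if_finite(1)[OF finite_tri_pts, of u v w y]
      arg_min_least[OF finite_tri_pts, of u v w _ y] q(1) by blast+
  have pv: "y p < y v" using pmin[OF q(1)] qv by simp
  define a g where "a q = acoord u v w q" and "g q = acoord u w v q" for q
  have dec: "q - u = a q *\<^sub>R (v - u) + g q *\<^sub>R (w - u)" for q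
    unfolding a_def g_def by (rule acoord_decomp[OF nd])
  have yq: "y q = a q * y v + g q * y w" for q
    unfolding y_def by (subst dec) (simp add: inner_add_left)
  have pin: "p \<in> P" "p \<noteq> u" "0 \<le> a p" "0 \<le> g p" "a p + g p \<le> 1"
    using pT by (auto simp: tri_pts_def a_def g_def)
  have "a p \<noteq> 0" using acoord_zero_collinear[OF P(1) P(3) pin(1) nd] pin pv vw by (auto simp: a_def)
  moreover have "g p \<noteq> 0" using acoord_zero_collinear[OF P(1) P(2) pin(1) nd'] pin pv by (auto simp: g_def)
  ultimately have ag: "0 < a p" "0 < g p" using pin by auto
  have yp: "0 < y p" unfolding yq[of p] using ag y0 by (simp add: add_pos_pos)
  have "visible S u p"
  proof (rule visible_in_corner[OF P P(1) pin(1) pin(2)[symmetric] nd vis])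
    show "\<not> (0 < acoord u v w d \<and> 0 < acoord u w v d)" if "is_constraint S u d" for d
      by (rule subcone_no_constraint_between[OF r v w nd that])
    \<comment> \<open>With these weights the cutting line is the perpendicular to the bisector at
      height \<open>y p\<close>.\<close>
    show "1 \<le> y v / y p" "1 \<le> y w / y p" using yp pv vw by auto
    have l: "y v / y p * acoord u v w q + y w / y p * acoord u w v q = y q / y p" for q
      unfolding yq[of q] a_def g_def by (simp add: add_divide_distrib mult.commute)
    show "q = u" if q: "q \<in> P" "0 \<le> acoord u v w q" "0 \<le> acoord u w v q"
      "y v / y p * acoord u v w q + y w / y p * acoord u w v q < 1" for q
    proof (rule ccontr)
      assume "q \<noteq> u"
      have qp: "y q < y p" using q(4) yp unfolding l by simp
      \<comment> \<open>Both \<open>v\<close> and \<open>w\<close> are above \<open>p\<close>, so a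
        point of the angle below \<open>p\<close> already lies in the triangle.\<close>
      have "y p * a q + y p * g q \<le> y v * a q + y w * g q"
        using q(2,3) pv vw unfolding a_def g_def by (intro add_mono mult_right_mono) auto
      then have "y p * (a q + g q) < y p * 1" using qp yq[of q] by (simp add: algebra_simps)
      then have "a q + g q \<le> 1" using yp by simp
      then have "q \<in> tri_pts u v w" using q \<open>q \<noteq> u\<close> by (simp add: tri_pts_def a_def g_def)
      then show False using pmin qp by fastforce
    qed
    show "y v / y p * acoord u v w p + y w / y p * acoord u w v p \<le> 1"
      unfolding l using yp by simp
  qed (use acoord_vertices[OF nd] acoord_vertices[OF nd'] ag in \<open>auto simp: a_def g_def\<close>)
  moreover have "in_subcone S N i u r p"
    by (rule in_subcone_comb[OF v w dec]) (use ag in auto)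
  ultimately have "y v \<le> y p" using closest[OF pin(1)] by (simp add: y_def)
  then show False using pv by simp
qed

end

section \<open>The spanning bound\<close>

lemma in_cone_visible_reach:
  fixes k x N :: nat
  assumes N: "N = 4 * k + x" "x \<in> {3, 4, 5}" "k \<ge> 1"
    and cp: "finite P" "general_position N P" "valid_constraints P S"
    and uw: "u \<in> P" "w \<in> P" "visible S u w" "in_cone N i u w"
  shows "reach (theta_edge P S N) u w (cone_bound (theta N / 2) (cconst N x) N i (w - u))"
proof -
  have N7: "N \<ge> 7" using N by auto
  interpret constrained_points N P S by unfold_locales (use N7 cp in auto)
  note th = theta_bounds[OF N7]
  define h c \<tau> A where "h = theta N / 2" and "c = cconst N x" and "\<tau> = tan h" and "A = 1 / cos h + c * \<tau>"
  have c1: "1 \<le> c" using cconst_turn_limit[OF N7] by (simp add: c_def)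
  have \<tau>: "0 < \<tau>" using th by (simp add: \<tau>_def h_def)
  have cos_h: "0 < cos h" using th by (simp add: h_def)
  \<comment> \<open>Heights are real, so the induction counts the triples of two points and a cone
    with height below the current one; passing to a lower pair removes at least the triple of that
    pair.\<close>
  define lower where "lower b = {(p, q, j) \<in> P \<times> P \<times> {..<N}. (q - p) \<bullet> bis N j < b}" for b
  have fin: "finite (lower b)" for b
    by (rule finite_subset[of _ "P \<times> P \<times> {..<N}"]) (use finP in \<open>auto simp: lower_def\<close>)
  show ?thesis
    using uw unfolding h_def[symmetric] c_def[symmetric]
  proof (induction "card (lower ((w - u) \<bullet> bis N i))" arbitrary: u w i rule: less_induct)
    case less
    note uw = less.prems
    define H where "H = (w - u) \<bullet> bis N i"
    have IH: "reach (theta_edge P S N) s t (cone_bound h c N j (t - s))"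
      if st: "s \<in> P" "t \<in> P" "visible S s t" "in_cone N j s t" and lt: "(t - s) \<bullet> bis N j < H" for s t j
    proof (rule less.hyps[OF _ st])
      have "(s, t, j) \<in> lower H" using st lt by (simp add: lower_def in_cone_def)
      moreover have "(s, t, j) \<notin> lower ((t - s) \<bullet> bis N j)" by (simp add: lower_def)
      moreover have "lower ((t - s) \<bullet> bis N j) \<subseteq> lower H" using lt by (auto simp: lower_def)
      ultimately have "lower ((t - s) \<bullet> bis N j) \<subset> lower H" by blast
      then show "card (lower ((t - s) \<bullet> bis N j)) < card (lower ((w - u) \<bullet> bis N i))"
        unfolding H_def[symmetric] by (rule psubset_card_mono[OF fin])
    qed
    have iN: "i < N" using uw by (simp add: in_cone_def)
    obtain r where r: "subcone_ref S N i u r" "in_subcone S N i u r w"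
      using subcone_ref_exists[OF uw(1,2,4)] .
    define C where "C = {q \<in> P. in_subcone S N i u r q \<and> visible S u q}"
    define v where "v = arg_min_on (\<lambda>q. (q - u) \<bullet> bis N i) C"
    have C: "finite C" "w \<in> C" using finP uw r by (auto simp: C_def)
    have vC: "v \<in> C" and vmin: "\<And>q. q \<in> C \<Longrightarrow> (v - u) \<bullet> bis N i \<le> (q - u) \<bullet> bis N i"
      unfolding v_def using arg_min_if_finite(1)[OF C(1), of "\<lambda>q. (q - u) \<bullet> bis N i"]
        arg_min_least[OF C(1), of _ "\<lambda>q. (q - u) \<bullet> bis N i"] C(2) by blast+
    have v: "v \<in> P" "in_subcone S N i u r v" "visible S u v" "in_cone N i u v"
      using vC by (auto simp: C_def in_subcone_def)
    have closest: "(v - u) \<bullet> bis N i \<le> (q - u) \<bullet> bis N i"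
      if "q \<in> P" "in_subcone S N i u r q" "visible S u q" for q
      using vmin that by (simp add: C_def)
    have "selects P S N u v" unfolding selects_def using uw v r closest by blast
    then have uv: "reach (theta_edge P S N) u v (dist u v)" by (intro reach_edge) (simp add: theta_edge_def)
    have wy: "0 < (w - u) \<bullet> bis N i" "\<bar>cross2 (w - u) (bis N i)\<bar> \<le> \<tau> * ((w - u) \<bullet> bis N i)"
      and vy: "0 < (v - u) \<bullet> bis N i" "\<bar>cross2 (v - u) (bis N i)\<bar> \<le> \<tau> * ((v - u) \<bullet> bis N i)"
      using uw(4) v(4) in_cone_iff[OF th(4,3)] by (auto simp: \<tau>_def h_def)
    show ?case
    proof (cases "v = w")
      case True
      have "norm (w - u) \<le> A * ((w - u) \<bullet> bis N i) + c * \<bar>cross2 (w - u) (bis N i)\<bar>"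
        unfolding A_def \<tau>_def
        by (rule norm_le_corner_path) (use norm_bis_coords[of "w - u" N i] wy cos_h c1 in \<open>auto simp: \<tau>_def\<close>)
      then show ?thesis using uv unfolding True
        by (elim reach_mono) (simp add: cone_bound_def A_def \<tau>_def dist_norm norm_minus_commute)
    next
      case False
      have "v \<noteq> u" "w \<noteq> u" using v(4) uw(4) by (auto simp: in_cone_def)
      then have nd: "orient u v w \<noteq> 0" using not_collinear[of u v w] uw v False by auto
      \<comment> \<open>Mirroring at the bisector, if necessary, puts \<open>v\<close> to the left
        of \<open>u w\<close>.\<close>
      define sg :: int where "sg = (if orient u v w < 0 then 1 else -1)"
      have sg: "sg = 1 \<or> sg = -1" by (simp add: sg_def)
      define x' y where "x' p = of_int sg * cross2 (p - u) (bis N i)" and "y p = (p - u) \<bullet> bis N i" for p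
      have absx: "\<bar>x' p\<bar> = \<bar>cross2 (p - u) (bis N i)\<bar>" for p using sg by (auto simp: x'_def abs_mult)
      have norm2: "(norm (p - u))\<^sup>2 = (y p)\<^sup>2 + (x' p)\<^sup>2" for p
        using norm_bis_coords[of "p - u" N i] absx[of p] unfolding y_def by (metis power2_abs)
      have vyw: "y v \<le> y w" using closest[OF uw(2) r(2) uw(3)] by (simp add: y_def)
      have left: "x' v * y w < x' w * y v"
      proof -
        have "x' v * y w - x' w * y v = of_int sg * orient u v w"
          unfolding orient_def cross2_bis_coords[of "v - u" "w - u" N i] x'_def y_def by (simp add: algebra_simps)
        also have "\<dots> < 0" using nd by (auto simp: sg_def)
        finally show ?thesis by simp
      qed
      \<comment> \<open>Chosen as a bound for \<open>x'\<close> on the triangle with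
        \<open>2 * m - x' w = \<bar>x' w\<bar>\<close>.\<close>
      define m where "m = max 0 (x' w)"
      have "reach (theta_edge P S N) v w (A * (y w - y v) + c * (2 * m - x' v - x' w))"
      proof (rule chain_reach[where x = x' and y = y and \<tau> = \<tau> and H = H and u = u])
        show "x' p = a * x' q + g * x' s" if "p - u = a *\<^sub>R (q - u) + g *\<^sub>R (s - u)" for a g p q s
          unfolding x'_def that by (simp only: cross2_linear(1,5)) (simp add: algebra_simps)
        show "y p = a * y q + g * y s" if "p - u = a *\<^sub>R (q - u) + g *\<^sub>R (s - u)" for a g p q s
          unfolding y_def that by (simp add: inner_add_left)
        show "reach (theta_edge P S N) s t (A * (y t - y s) + c * \<bar>x' t - x' s\<bar>)"
          if st: "s \<in> P" "t \<in> P" "visible S s t" "0 < y s" "\<bar>x' s\<bar> \<le> \<tau> * y s" "\<bar>x' t\<bar> \<le> \<tau> * y t"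
            "y s < y t" "y t \<le> H" "x' s \<le> x' t \<or> \<bar>x' t - x' s\<bar> \<le> \<tau> * (y t - y s)" for s t
        proof -
          have ts: "t - s = (t - u) - (s - u)" by simp
          have X: "x' t - x' s = of_int sg * cross2 (t - s) (bis N i)"
            unfolding x'_def ts cross2_linear(3)[of "t - u" "s - u"] by (simp add: algebra_simps)
          have Y: "y t - y s = (t - s) \<bullet> bis N i"
            unfolding y_def by (simp add: inner_diff_left)
          have "\<exists>j<N. norm (t - s) * cos (theta N / 2) \<le> (t - s) \<bullet> bis N j \<and> (t - s) \<bullet> bis N j < H \<and>
              cone_bound (theta N / 2) (cconst N x) N j (t - s)
              \<le> (1 / cos (theta N / 2) + cconst N x * tan (theta N / 2)) * (y t - y s) + cconst N x * \<bar>x' t - x' s\<bar>"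
          proof (rule edge_cone_bound[OF N iN sg X Y, where V = "y s"])
            \<comment> \<open>Both ends lie in the cone of \<open>u\<close>, so their distance
              across is at most \<open>tan h\<close> times the sum of their heights.\<close>
            show "x' t - x' s \<le> tan (theta N / 2) * (y t - y s + 2 * y s)"
              using st(5,6) unfolding \<tau>_def[symmetric] h_def[symmetric] by (auto simp: algebra_simps)
          qed (use st in \<open>auto simp: \<tau>_def h_def\<close>)
          then obtain j where j: "j < N" "norm (t - s) * cos h \<le> (t - s) \<bullet> bis N j" "(t - s) \<bullet> bis N j < H"
            "cone_bound h c N j (t - s) \<le> A * (y t - y s) + c * \<bar>x' t - x' s\<bar>"
            unfolding A_def \<tau>_def h_def c_def by blast
          have "t \<noteq> s" using st by auto
          then have "in_cone N j s t" using j by (simp add: in_cone_def h_def)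
          from IH[OF st(1-3) this j(3)] j(4) show ?thesis by (rule reach_mono)
        qed
        show "y v < y q" if "q \<in> tri_pts u v w" "q \<noteq> v" for q
          unfolding y_def
          by (rule closest_lowest_in_triangle[OF uw(1) v(1) uw(2) nd v(3) uw(3) r(1) v(2) r(2) closest that])
        show "x' q \<le> m" if "q \<in> tri_pts u v w" for q
        proof -
          define a g where "a = acoord u v w q" and "g = acoord u w v q"
          have ag: "0 \<le> a" "0 \<le> g" "a + g \<le> 1" using that by (auto simp: tri_pts_def a_def g_def)
          \<comment> \<open>Here \<open>v\<close> is left of \<open>u w\<close> and no higher than
            \<open>w\<close>.\<close>
          have "x' v \<le> m"
          proof (rule ccontr)
            assume "\<not> x' v \<le> m"
            then have vm: "m < x' v" by simp
            have "x' w * y v \<le> m * y v" using vy by (intro mult_right_mono) (auto simp: m_def y_def)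
            also have "\<dots> \<le> m * y w" using vyw by (intro mult_left_mono) (auto simp: m_def)
            also have "\<dots> < x' v * y w" using vm wy by (simp add: y_def)
            finally show False using left by simp
          qed
          have "q - u = a *\<^sub>R (v - u) + g *\<^sub>R (w - u)" unfolding a_def g_def by (rule acoord_decomp[OF nd])
          then have "x' q = a * x' v + g * x' w"
            unfolding x'_def by (simp only: cross2_linear(1,5)) (simp add: algebra_simps)
          also have "\<dots> \<le> a * m + g * m" using ag \<open>x' v \<le> m\<close>
            by (intro add_mono mult_left_mono) (auto simp: m_def)
          also have "\<dots> \<le> m" using mult_right_mono[OF ag(3), of m] by (simp add: m_def algebra_simps)
          finally show ?thesis .
        qed
        show "\<not> (0 < acoord u v w d \<and> 0 < acoord u w v d)" if "is_constraint S u d" for d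
          by (rule subcone_no_constraint_between[OF r(1) v(2) r(2) nd that])
        show "\<bar>x' w\<bar> \<le> \<tau> * y w" "\<bar>x' v\<bar> \<le> \<tau> * y v" "0 < y w" "0 < y v" "y w \<le> H"
          using wy vy by (auto simp: absx y_def H_def)
      qed (use uw v nd left c1 \<tau> in auto)
      from reach_trans[OF uv this]
      show ?thesis
      proof (rule reach_mono)
        \<comment> \<open>The first edge is paid for with the signed term \<open>c * x' v\<close>,
          which cancels against the chain.\<close>
        have "norm (v - u) \<le> A * y v + c * x' v"
          unfolding A_def \<tau>_def
          by (rule norm_le_corner_path[OF norm2]) (use vy cos_h c1 absx in \<open>auto simp: \<tau>_def y_def\<close>)
        then have "dist u v \<le> A * y v + c * x' v" by (simp add: dist_norm norm_minus_commute)
        moreover have "2 * m - x' w = \<bar>x' w\<bar>" by (simp add: m_def)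
        then have "c * (2 * m - x' v - x' w) = c * \<bar>x' w\<bar> - c * x' v"
          by (simp add: algebra_simps)
        moreover have "A * (y w - y v) = A * y w - A * y v" by (simp add: algebra_simps)
        moreover have "cone_bound h c N i (w - u) = A * y w + c * \<bar>x' w\<bar>"
          unfolding cone_bound_def absx y_def A_def \<tau>_def ..
        ultimately show "dist u v + (A * (y w - y v) + c * (2 * m - x' v - x' w)) \<le> cone_bound h c N i (w - u)"
          by linarith
      qed
    qed
  qed
qed

theorem theorem2:
  fixes k x i :: nat and P :: "pt set" and S :: "(pt \<times> pt) set" and u w :: pt
  defines "N \<equiv> 4 * k + x"
  assumes "k \<ge> 1" and "x \<in> {3, 4, 5}"
    and "finite P" and "general_position N P" and "valid_constraints P S"
    and "u \<in> P" and "w \<in> P" and "u \<noteq> w" and "visible S u w"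
    and "in_cone N i u w"
  shows "\<exists>xs. is_path (theta_edge P S N) xs u w \<and>
           path_len xs \<le>
             (cos (vangle (w - u) (canon_mid N i u w - u)) / cos (theta N / 2)
              + (cos (vangle (w - u) (canon_mid N i u w - u)) * tan (theta N / 2)
                 + sin (vangle (w - u) (canon_mid N i u w - u))) * cconst N x)
             * dist u w"
proof -
  have N7: "N \<ge> 7" using assms(2,3) unfolding N_def by auto
  note th = theta_bounds[OF N7]
  define y X n where "y = (w - u) \<bullet> bis N i" and "X = cross2 (w - u) (bis N i)" and "n = norm (w - u)"
  define \<alpha> where "\<alpha> = vangle (w - u) (canon_mid N i u w - u)"
  have y: "0 < y" using in_cone_iff[OF th(4,3)] assms(11) by (simp add: y_def)
  have n0: "0 < n" using assms(9) by (simp add: n_def)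
  have n2: "n\<^sup>2 = y\<^sup>2 + X\<^sup>2" unfolding n_def y_def X_def by (rule norm_bis_coords)
  have "norm (bis N i) = 1" by (simp add: bis_def norm_prod_def)
  \<comment> \<open>The vector to the midpoint is a positive multiple of the unit bisector.\<close>
  then have \<alpha>: "\<alpha> = arccos (y / n)"
    using y n0 unfolding \<alpha>_def vangle_def canon_mid_def by (simp flip: y_def n_def)
  have "y \<le> n" by (rule power2_le_imp_le) (use n2 n0 in auto)
  then have bounds: "- 1 \<le> y / n" "y / n \<le> 1" using y n0 by (auto simp: field_simps)
  have cos: "cos \<alpha> = y / n" unfolding \<alpha> using bounds by (rule cos_arccos)
  have "(y / n)\<^sup>2 + (X / n)\<^sup>2 = n\<^sup>2 / n\<^sup>2"
    unfolding n2 by (simp only: power_divide add_divide_distrib n2)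
  then have "1 - (y / n)\<^sup>2 = (X / n)\<^sup>2" using n0 by simp
  then have sin: "sin \<alpha> = \<bar>X\<bar> / n" unfolding \<alpha> using bounds n0 by (simp add: sin_arccos)
  have "reach (theta_edge P S N) u w (cone_bound (theta N / 2) (cconst N x) N i (w - u))"
    by (rule in_cone_visible_reach) (use assms in auto)
  moreover have "cone_bound (theta N / 2) (cconst N x) N i (w - u) =
      (cos \<alpha> / cos (theta N / 2) + (cos \<alpha> * tan (theta N / 2) + sin \<alpha>) * cconst N x) * dist u w"
  proof -
    have "dist u w = n" by (simp add: n_def dist_norm norm_minus_commute)
    moreover have "cos \<alpha> * n = y" "sin \<alpha> * n = \<bar>X\<bar>" using cos sin n0 by auto
    moreover have "(C / D + (C * T + s) * c) * n = (1 / D + c * T) * (C * n) + c * (s * n)" for C D T s c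
      by (simp add: algebra_simps)
    ultimately show ?thesis unfolding cone_bound_def y_def[symmetric] X_def[symmetric] by metis
  qed
  ultimately show ?thesis unfolding reach_def \<alpha>_def by metis
qed

end
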